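(* Let $f\in C([0,1])$ satisfy $f(0)=f(1)=0$ and suppose there is $k>0$ with $|f(s)|\le ks$ and $|f(s)|\le k(1-s)$ for every $s\in[0,1]$. Let $f$ be of type A, i.e. $f>0$ on $(0,1)$, and assume that $f$ is locally Lipschitz continuous and has a unique local maximum point $v_{\max}\in(0,1)$. For $\varepsilon>0$ let $c^*_\varepsilon$ be the critical speed for $$\varepsilon\left(\frac{v'}{\sqrt{1-(v')^2}}\right)'-c\,v'+f(v)=0,\qquad(\ast)$$ and let $v_\varepsilon$ be the critical profile with $v_\varepsilon(0)=\mathcal{V}_0$, where $\mathcal{V}_0=1/2$. Let $F(v)=\int_0^vf(s)\,ds$ and let $v_+\in(0,1)$ be the largest solution of the equation $F(v)=vf(v)$. Then, for $\varepsilon\to0^+$, it holds that $c^*_\varepsilon\to f(v_+)$ and $v_\varepsilon\to\bar v$ uniformly in $\mathbb{R}$, where: - if $v_+\ge\mathcal{V}_0$, $$\bar v(z)=\begin{cases}\mathcal{V}_L(z;0,\mathcal{V}_0)& z\in(-\infty,v_+-\mathcal{V}_0]\\ \mathcal{V}_I(z;v_+-\mathcal{V}_0,v_+)& z\in(v_+-\mathcal{V}_0,+\infty);\end{cases}$$ - if $v_+<\mathcal{V}_0$, $$\bar v(z)=\begin{cases}\mathcal{V}_L(z;z_+,v_+)& z\in(-\infty,z_+]\\ \mathcal{V}_I(z;0,\mathcal{V}_0)& z\in(z_+,+\infty),\end{cases}$$ where, in the latter case, $z_+<0$ is the unique real number for which $\mathcal{V}_I(z_+;0,\mathcal{V}_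0)=v_+$.
   Context: A heteroclinic solution of $(\ast)$ is a monotone $C^2$ solution $v:\mathbb{R}\to[0,1]$ (with $|v'|<1$) such that $v(-\infty)=0$, $v(+\infty)=1$. For $f$ of type A, the speeds $c\in\mathbb{R}$ for which such a solution exists (equivalently, for which the problem $y'=c\,\frac{\sqrt{y(2\varepsilon+y)}}{\varepsilon+y}-f(v)$, $y(0)=y(1)=0$, $y>0$ on $(0,1)$ is solvable) form an interval $[c^*_\varepsilon,+\infty)$; $c^*_\varepsilon$ is the critical speed, and the heteroclinic with $c=c_\varepsilon^*$, unique up to translations in $z$, is the critical profile. For $\underline z\in\mathbb{R}$ and $\underline v\in(0,1)$, $$\mathcal{V}_L(z;\underline z,\underline v)=\begin{cases}0& z\in(-\infty,\underline z-\underline v)\\ z-\underline z+\underline v& z\in[\underline z-\underline v,1+\underline z-\underline v]\\ 1& z\in(1+\underline z-\underline v,+\infty),\end{cases}$$ and $\mathcal{V}_I(\cdot;\underline z,\underline v)$ is the unique (positive) solution of $\bar c\,v'=f(v)$, $v(\underline z)=\underline v$, where $\bar c=\lim_{\varepsilon\to0^+}c^*_\varepsilon$ (so $\bar c=f(v_+)$). *)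

theory Defs
  imports "HOL-Analysis.Analysis"
begin

text \<open>
  A reaction term is a function \<^term>\<open>f :: real \<Rightarrow> real\<close> of which only the values on
  \<open>[0,1]\<close> matter: every notion below evaluates \<open>f\<close> only at points of \<open>[0,1]\<close>.
\<close>

definition local_max_point_on :: "real set \<Rightarrow> (real \<Rightarrow> real) \<Rightarrow> real \<Rightarrow> bool" where
  "local_max_point_on S f s \<longleftrightarrow> s \<in> S \<and> (\<exists>d>0. \<forall>t\<in>S. \<bar>t - s\<bar> < d \<longrightarrow> f t \<le> f s)"

text \<open>
  The two \<open>C1_differentiable_on\<close> conjuncts say that \<open>v\<close> is of class \<open>C\<^sup>2\<close>. The limits at
  infinity force the direction of monotonicity, so \<open>mono\<close> loses nothing.
\<close>
definition heteroclinic :: "(real \<Rightarrow> real) \<Rightarrow> real \<Rightarrow> real \<Rightarrow> (real \<Rightarrow> real) \<Rightarrow> bool" where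
  "heteroclinic f \<epsilon> c v \<longleftrightarrow>
     (\<forall>z. v z \<in> {0..1}) \<and> mono v \<and>
     v C1_differentiable_on UNIV \<and> deriv v C1_differentiable_on UNIV \<and>
     (\<forall>z. \<bar>deriv v z\<bar> < 1) \<and>
     (\<forall>z. \<epsilon> * deriv (\<lambda>x. deriv v x / sqrt (1 - (deriv v x)\<^sup>2)) z - c * deriv v z + f (v z) = 0) \<and>
     (v \<longlongrightarrow> 0) at_bot \<and> (v \<longlongrightarrow> 1) at_top"

definition admissible_speeds :: "(real \<Rightarrow> real) \<Rightarrow> real \<Rightarrow> real set" where
  "admissible_speeds f \<epsilon> = {c. \<exists>v. heteroclinic f \<epsilon> c v}"

definition critical_speed :: "(real \<Rightarrow> real) \<Rightarrow> real \<Rightarrow> real" where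
  "critical_speed f \<epsilon> = (THE c. admissible_speeds f \<epsilon> = {c..})"

text \<open>
  The critical profile is unique up to translation; it is normalised by prescribing its value
  \<open>v0\<close> at \<open>0\<close>.
\<close>
definition critical_profile :: "(real \<Rightarrow> real) \<Rightarrow> real \<Rightarrow> real \<Rightarrow> real \<Rightarrow> real" where
  "critical_profile f v0 \<epsilon> = (THE v. heteroclinic f \<epsilon> (critical_speed f \<epsilon>) v \<and> v 0 = v0)"

definition limit_speed :: "(real \<Rightarrow> real) \<Rightarrow> real" where
  "limit_speed f = Lim (at_right 0) (critical_speed f)"

definition V_L :: "real \<Rightarrow> real \<Rightarrow> real \<Rightarrow> real" where
  "V_L z0 v0 z =
     (if z < z0 - v0 then 0 else if z \<le> 1 + z0 - v0 then z - z0 + v0 else 1)"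

definition V_I :: "(real \<Rightarrow> real) \<Rightarrow> real \<Rightarrow> real \<Rightarrow> real \<Rightarrow> real" where
  "V_I f z0 v0 =
     (THE w. (\<forall>z. 0 < w z \<and> w z \<le> 1) \<and>
             (\<forall>z. w differentiable at z \<and> limit_speed f * deriv w z = f (w z)) \<and>
             w z0 = v0)"

definition v_plus :: "(real \<Rightarrow> real) \<Rightarrow> real" where
  "v_plus f = (GREATEST v. v \<in> {0<..<1} \<and> integral {0..v} f = v * f v)"

definition V0 :: real where
  "V0 = 1/2"

definition z_plus :: "(real \<Rightarrow> real) \<Rightarrow> real" where
  "z_plus f = (THE z. V_I f 0 V0 z = v_plus f)"

definition v_bar :: "(real \<Rightarrow> real) \<Rightarrow> real \<Rightarrow> real" where
  "v_bar f z =
     (if v_plus f \<ge> V0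
      then (if z \<le> v_plus f - V0 then V_L 0 V0 z else V_I f (v_plus f - V0) (v_plus f) z)
      else (if z \<le> z_plus f then V_L (z_plus f) (v_plus f) z else V_I f 0 V0 z))"

end

theory Submission
  imports Defs
begin

text \<open>
  Along a monotone profile \<open>v\<close> the energy \<open>y = \<epsilon> (1 / sqrt (1 - v'\<^sup>2) - 1)\<close>, viewed as a function of
  the value \<open>s = v z\<close>, satisfies \<open>y' = c * slope \<epsilon> y - f s\<close> with \<open>y 0 = y 1 = 0\<close>, and
  \<open>v' = slope \<epsilon> (y v)\<close>. The function \<open>slope \<epsilon>\<close> is nondecreasing, but not Lipschitz at \<open>0\<close>; its
  monotonicity makes the first-order problem well posed backward from \<open>s = 1\<close>. So for every
  \<open>c > 0\<close> there is one backward orbit, heteroclinic profiles of speed \<open>c\<close> exist only when this orbit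
  ends at \<open>0\<close> and are then exactly the solutions of \<open>v' = slope \<epsilon> (y v)\<close> with values in \<open>(0,1)\<close> (\<open>heteroclinic_imp_connecting\<close>,
  \<open>flow_heteroclinic\<close>), and separation of variables makes them unique up to translation for every
  admissible speed. The terminal value \<open>y 0\<close> is nonincreasing and \<open>1\<close>-Lipschitz in \<open>c\<close>, hence the
  admissible speeds form a closed half-line (\<open>connecting_eq\<close>).

  Put \<open>F s = \<integral>\<^sub>0\<^sup>s f\<close> and \<open>c\<^sub>0 = f v\<^sub>+ = F v\<^sub>+ / v\<^sub>+ = max (F s / s)\<close>. Since \<open>slope < 1\<close>, an orbit that ends at
  \<open>0\<close> satisfies \<open>0 \<le> y s \<le> c s - F s\<close>, and \<open>s = v\<^sub>+\<close> gives \<open>c \<ge> c\<^sub>0\<close>. Conversely, since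
  \<open>slope \<epsilon>\<close> tends to \<open>1\<close> on positive energies, an explicit upper barrier vanishing at \<open>0\<close> shows that
  \<open>c\<^sub>0 + \<delta>\<close> is admissible for small \<open>\<epsilon>\<close> (\<open>eventually_connecting\<close>). So the critical speed tends to \<open>c\<^sub>0\<close>.

  On \<open>(0, v\<^sub>+)\<close> the critical energy tends to \<open>c\<^sub>0 s - F s > 0\<close>, hence the slope tends to \<open>1\<close>. On
  \<open>[v\<^sub>+, 1)\<close>, where \<open>f\<close> decreases, the energy is nonincreasing and at most \<open>(c - c\<^sub>0) v\<^sub>+\<close>, which tends to
  \<open>0\<close>; integrating the equation over short intervals shows that the slope tends to the equilibrium
  value \<open>f s / c\<^sub>0\<close> (\<open>speed_profile_tendsto\<close>). By dominated convergence the times at which the critical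
  profile takes the values of \<open>(0,1)\<close> converge. Profiles being monotone and \<open>1\<close>-Lipschitz, this gives
  uniform convergence to the function with the limiting times (\<open>uniform_limit_monotone\<close>), and this
  function is the announced union of \<open>0\<close>, a segment of slope \<open>1\<close> and a solution of \<open>c\<^sub>0 v' = f v\<close>.
\<close>

section \<open>Initial value problems with a monotone right-hand side\<close>

text \<open>With a delay \<open>h\<close> in the unknown, Picard iterates become stationary on \<open>[0, n h]\<close> after \<open>n\<close> steps.\<close>

lemma delayed_ode_exists:
  fixes g \<Phi> :: "real \<Rightarrow> real" and h :: real
  assumes g: "continuous_on {0..1} g" and \<Phi>: "continuous_on UNIV \<Phi>" and h: "h > 0"
  shows "\<exists>X. X 0 = 0 \<and> (\<forall>t\<in>{0..1}. (X has_real_derivative g t - \<Phi> (X (max 0 (t - h))))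
           (at t within {0..1}))"
proof -
  define T where "T W t = integral {0..t} (\<lambda>s. g s - \<Phi> (W (max 0 (s - h))))"
    for W :: "real \<Rightarrow> real" and t
  define W where "W n = (T ^^ n) (\<lambda>_. 0)" for n
  have W0: "W 0 = (\<lambda>_. 0)" and WS: "W (Suc n) = T (W n)" for n
    by (simp_all add: W_def)
  have integrand: "continuous_on {0..1} (\<lambda>s. g s - \<Phi> (U (max 0 (s - h))))"
    if "continuous_on {0..1} U" for U
  proof -
    have "continuous_on {0..1} (\<lambda>s. U (max 0 (s - h)))"
      by (rule continuous_on_compose2[OF that]) (use h in \<open>auto intro!: continuous_intros\<close>)
    hence "continuous_on {0..1} (\<lambda>s. \<Phi> (U (max 0 (s - h))))"
      using continuous_on_compose2[OF \<Phi>] by blast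
    with g show ?thesis by (intro continuous_intros)
  qed
  have deriv_T: "(T U has_real_derivative g t - \<Phi> (U (max 0 (t - h)))) (at t within {0..1})"
    if "continuous_on {0..1} U" "t \<in> {0..1}" for U t
    unfolding T_def using integral_has_real_derivative[OF integrand[OF that(1)] that(2)] .
  have contW: "continuous_on {0..1} (W n)" for n
  proof (induction n)
    case (Suc n)
    show ?case unfolding WS
      using deriv_T[OF Suc] by (intro DERIV_continuous_on)
  qed (simp add: W0)
  have stab: "W (Suc n) t = W n t" if "0 \<le> t" "t \<le> real n * h" for n t
    using that
  proof (induction n arbitrary: t)
    case 0
    thus ?case by (simp add: W0 WS T_def)
  next
    case (Suc n)
    have "W (Suc n) (max 0 (s - h)) = W n (max 0 (s - h))" if "s \<in> {0..t}" for s
      using that Suc.prems h by (intro Suc.IH) (auto simp: algebra_simps)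
    thus ?case
      unfolding WS[of "Suc n"] WS[of n] T_def
      by (intro integral_cong) (auto simp: WS T_def)
  qed
  obtain n :: nat where n: "1 / h \<le> real n" using real_arch_simple by blast
  hence "1 \<le> real n * h" using h by (simp add: field_simps)
  hence eq: "W (Suc n) t = W n t" if "t \<in> {0..1}" for t
    using that by (intro stab) auto
  have "(W (Suc n) has_real_derivative g t - \<Phi> (W (Suc n) (max 0 (t - h)))) (at t within {0..1})"
    if "t \<in> {0..1}" for t
  proof -
    have "max 0 (t - h) \<in> {0..1}" using that h by auto
    thus ?thesis using deriv_T[OF contW[of n] that] eq[of "max 0 (t - h)"] by (simp add: WS)
  qed
  moreover have "W (Suc n) 0 = 0" by (simp add: WS T_def)
  ultimately show ?thesis by blast
qed

text \<open>Tonelli's delayed approximations converge: since \<open>\<Phi>\<close> is nondecreasing, the squared distance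
  of two of them can only grow through the difference between the delayed and the actual value.
  No Lipschitz condition on \<open>\<Phi>\<close> is required.\<close>

lemma monotone_ode_exists:
  fixes g \<Phi> :: "real \<Rightarrow> real"
  assumes g: "continuous_on {0..1} g" and \<Phi>: "continuous_on UNIV \<Phi>" and mono: "mono \<Phi>"
    and B: "\<And>x. \<bar>\<Phi> x\<bar> \<le> B"
  shows "\<exists>X. X 0 = 0 \<and>
    (\<forall>t\<in>{0..1}. (X has_real_derivative g t - \<Phi> (X t)) (at t within {0..1}))"
proof -
  define h where "h n = 1 / real (Suc n)" for n
  have hpos: "h n > 0" for n by (simp add: h_def)
  have hlim: "h \<longlonglongrightarrow> 0" unfolding h_def using LIMSEQ_inverse_real_of_nat
    by (simp add: inverse_eq_divide)
  define \<tau> where "\<tau> n t = max 0 (t - h n)" for n t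
  have "\<exists>X. \<forall>n. X n 0 = 0 \<and> (\<forall>t\<in>{0..1}. (X n has_real_derivative g t - \<Phi> (X n (\<tau> n t)))
           (at t within {0..1}))"
    unfolding \<tau>_def using delayed_ode_exists[OF g \<Phi> hpos] by metis
  then obtain X where X0: "\<And>n. X n 0 = 0"
    and Xd: "\<And>n t. t \<in> {0..1} \<Longrightarrow> (X n has_real_derivative g t - \<Phi> (X n (\<tau> n t))) (at t within {0..1})"
    by blast
  obtain C where C: "\<And>t. t \<in> {0..1} \<Longrightarrow> \<bar>g t\<bar> \<le> C"
    using compact_imp_bounded[OF compact_continuous_image[OF g compact_Icc]]
    unfolding bounded_iff by (metis imageI real_norm_def)
  define M where "M = C + B + 1"
  have "0 \<le> C" using C[of 0] by auto
  moreover have "0 \<le> B" using B[of 0] by auto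
  ultimately have M: "0 < M" "1 \<le> M" unfolding M_def by auto
  have bd: "\<bar>g t - \<Phi> x\<bar> \<le> M" if "t \<in> {0..1}" for t x
    using C[OF that] B[of x] by (auto simp: M_def)
  have \<tau>01: "\<tau> n t \<in> {0..1}" if "t \<in> {0..1}" for n t
    using that hpos[of n] by (auto simp: \<tau>_def)
  have lip: "\<bar>X n t - X n s\<bar> \<le> M * \<bar>t - s\<bar>" if "t \<in> {0..1}" "s \<in> {0..1}" for n t s
    using field_differentiable_bound[OF _ Xd, where B = M] bd that by auto
  have delay: "\<bar>X n (\<tau> n t) - X n t\<bar> \<le> M * h n" if "t \<in> {0..1}" for n t
  proof -
    have "\<bar>X n (\<tau> n t) - X n t\<bar> \<le> M * \<bar>\<tau> n t - t\<bar>" using lip[OF \<tau>01[OF that] that] .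
    also have "\<dots> \<le> M * h n" using that hpos[of n] M by (intro mult_left_mono) (auto simp: \<tau>_def)
    finally show ?thesis .
  qed
  have Xb: "\<bar>X n t\<bar> \<le> M" if "t \<in> {0..1}" for n t
  proof -
    have "\<bar>X n t\<bar> \<le> M * \<bar>t\<bar>" using lip[OF that, of 0 n] X0 by simp
    also have "\<dots> \<le> M * 1" using that M by (intro mult_left_mono) auto
    finally show ?thesis by simp
  qed
  have uc: "uniformly_continuous_on {-M..M} \<Phi>"
    using \<Phi> continuous_on_subset by (intro compact_uniformly_continuous) blast+
  have "uniformly_Cauchy_on {0..1} X"
    unfolding uniformly_Cauchy_on_def
  proof (intro allI impI)
    fix e :: real assume e: "e > 0"
    \<comment> \<open>chosen such that the bound \<open>8 M e'\<close> on the squared distance is below \<open>e\<^sup>2\<close>\<close>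
    define e' where "e' = e\<^sup>2 / (16 * M)"
    have e': "e' > 0" using e M by (simp add: e'_def)
    obtain d where d: "d > 0"
      "\<And>x y. x \<in> {-M..M} \<Longrightarrow> y \<in> {-M..M} \<Longrightarrow> dist x y < d \<Longrightarrow> dist (\<Phi> x) (\<Phi> y) < e'"
      using uc e' unfolding uniformly_continuous_on_def by metis
    have "(\<lambda>n. M * h n) \<longlonglongrightarrow> M * 0" using hlim by (intro tendsto_intros)
    hence "eventually (\<lambda>n. M * h n < d) sequentially" using d(1) by (simp add: order_tendsto_iff)
    then obtain N where N: "\<And>n. n \<ge> N \<Longrightarrow> M * h n < d" unfolding eventually_sequentially by blast
    have dl: "\<bar>\<Phi> (X n (\<tau> n t)) - \<Phi> (X n t)\<bar> \<le> e'" if "n \<ge> N" "t \<in> {0..1}" for n t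
    proof -
      have "dist (X n (\<tau> n t)) (X n t) < d"
        using delay[OF that(2), of n] N[OF that(1)] by (simp add: dist_real_def)
      moreover have "X n (\<tau> n t) \<in> {-M..M}" "X n t \<in> {-M..M}"
        using Xb[OF \<tau>01[OF that(2)], of n n] Xb[OF that(2), of n] by auto
      ultimately show ?thesis using d(2) by (force simp: dist_real_def)
    qed
    have "dist (X m t) (X n t) < e" if mn: "m \<ge> N" "n \<ge> N" and t: "t \<in> {0..1}" for m n t
    proof -
      define D where "D s = (X m s - X n s)\<^sup>2 - 8 * M * e' * s" for s
      define D' where "D' s = 2 * (X m s - X n s) * (\<Phi> (X n (\<tau> n s)) - \<Phi> (X m (\<tau> m s))) - 8 * M * e'" for s
      have Dd: "(D has_real_derivative D' s) (at s within {0..1})" if "s \<in> {0..1}" for s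
        unfolding D_def D'_def
        by (rule derivative_eq_intros Xd that refl)+ (simp add: algebra_simps)
      have D'neg: "D' s \<le> 0" if s: "s \<in> {0..1}" for s
      proof -
        define a b where "a = X m s" and "b = X n s"
        define p q where "p = \<Phi> (X m (\<tau> m s)) - \<Phi> a" and "q = \<Phi> (X n (\<tau> n s)) - \<Phi> b"
        have pq: "\<bar>p\<bar> \<le> e'" "\<bar>q\<bar> \<le> e'" using dl[OF mn(1) s] dl[OF mn(2) s] by (auto simp: p_def q_def a_def b_def)
        have ab: "\<bar>a - b\<bar> \<le> 2 * M" using Xb[OF s, of m] Xb[OF s, of n] by (auto simp: a_def b_def)
        have mm: "(a - b) * (\<Phi> b - \<Phi> a) \<le> 0"
        proof (cases "a \<le> b")
          case True
          thus ?thesis using monoD[OF mono, of a b] by (intro mult_nonpos_nonneg) auto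
        next
          case False
          thus ?thesis using monoD[OF mono, of b a] by (intro mult_nonneg_nonpos) auto
        qed
        have "(a - b) * (q - p) \<le> \<bar>a - b\<bar> * \<bar>q - p\<bar>" by (metis abs_ge_self abs_mult)
        also have "\<dots> \<le> (2 * M) * (2 * e')" using ab pq by (intro mult_mono) auto
        finally have "(a - b) * (q - p) \<le> 4 * M * e'" by simp
        with mm have "(a - b) * (\<Phi> b - \<Phi> a) + (a - b) * (q - p) \<le> 4 * M * e'" by linarith
        hence "(a - b) * ((\<Phi> b + q) - (\<Phi> a + p)) \<le> 4 * M * e'" by (simp add: algebra_simps)
        moreover have "D' s = 2 * ((a - b) * ((\<Phi> b + q) - (\<Phi> a + p))) - 8 * M * e'"
          by (simp add: D'_def a_def b_def p_def q_def)
        ultimately show ?thesis by linarith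
      qed
      have "D t \<le> D 0"
      proof (rule DERIV_nonpos_imp_decreasing_open[where a = 0 and b = t])
        show "0 \<le> t" using t by simp
        show "\<exists>y. (D has_real_derivative y) (at x) \<and> y \<le> 0" if "0 < x" "x < t" for x
        proof -
          have "x \<in> {0..1}" and "x \<in> interior {0..1}" using that t by auto
          thus ?thesis using Dd[of x] D'neg[of x] at_within_interior[of x "{0..1}"] by auto
        qed
        show "continuous_on {0..t} D"
        proof (rule continuous_on_subset)
          show "continuous_on {0..1} D" by (rule DERIV_continuous_on) (rule Dd)
          show "{0..t} \<subseteq> {0..1}" using t by auto
        qed
      qed
      hence "(X m t - X n t)\<^sup>2 \<le> 8 * M * e' * t" by (simp add: D_def X0)
      also have "\<dots> \<le> 8 * M * e' * 1" using t M e' by (intro mult_left_mono) auto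
      also have "\<dots> = e\<^sup>2 / 2" using M by (simp add: e'_def)
      also have "\<dots> < e\<^sup>2" using e by simp
      finally have "\<bar>X m t - X n t\<bar> < e" using e power2_less_imp_less[of "\<bar>X m t - X n t\<bar>" e] by simp
      thus ?thesis by (simp add: dist_real_def)
    qed
    thus "\<exists>M. \<forall>x\<in>{0..1}. \<forall>m\<ge>M. \<forall>n\<ge>M. dist (X m x) (X n x) < e" by blast
  qed
  then obtain L where L: "uniform_limit {0..1} X L sequentially"
    using Cauchy_uniformly_convergent[of "{0..1}" X] unfolding uniformly_convergent_on_def by auto
  have Lt: "(\<lambda>n. X n t) \<longlonglongrightarrow> L t" if "t \<in> {0..1}" for t
    using tendsto_uniform_limitI[OF L that] .
  have contX: "continuous_on {0..1} (X n)" for n by (rule DERIV_continuous_on) (rule Xd)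
  have contL: "continuous_on {0..1} L"
    by (rule uniform_limit_theorem[OF _ L]) (simp_all add: contX)
  have L0: "L 0 = 0" using LIMSEQ_unique[OF Lt[of 0], of 0] by (simp add: X0)
  have contI: "continuous_on {0..1} (\<lambda>s. g s - \<Phi> (L s))"
    by (rule continuous_on_diff[OF g continuous_on_compose2[OF \<Phi> contL]]) simp
  have eq: "L t = integral {0..t} (\<lambda>s. g s - \<Phi> (L s))" if t: "t \<in> {0..1}" for t
  proof -
    have ftc: "((\<lambda>s. g s - \<Phi> (X n (\<tau> n s))) has_integral X n t) {0..t}" for n
    proof -
      have "((\<lambda>s. g s - \<Phi> (X n (\<tau> n s))) has_integral X n t - X n 0) {0..t}"
      proof (rule fundamental_theorem_of_calculus)
        show "0 \<le> t" using t by simp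
        fix x assume x: "x \<in> {0..t}"
        have "(X n has_real_derivative g x - \<Phi> (X n (\<tau> n x))) (at x within {0..t})"
          using DERIV_subset[OF Xd[of x n], of "{0..t}"] x t by auto
        thus "(X n has_vector_derivative g x - \<Phi> (X n (\<tau> n x))) (at x within {0..t})"
          by (simp add: has_real_derivative_iff_has_vector_derivative)
      qed
      thus ?thesis by (simp add: X0)
    qed
    have pw: "(\<lambda>n. g s - \<Phi> (X n (\<tau> n s))) \<longlonglongrightarrow> g s - \<Phi> (L s)" if s: "s \<in> {0..t}" for s
    proof -
      have s1: "s \<in> {0..1}" using s t by auto
      have "(\<lambda>n. M * h n) \<longlonglongrightarrow> M * 0" using hlim by (intro tendsto_intros)
      hence lim0: "(\<lambda>n. M * h n) \<longlonglongrightarrow> 0" by simp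
      have "(\<lambda>n. X n (\<tau> n s) - X n s) \<longlonglongrightarrow> 0"
        by (rule Lim_null_comparison[OF _ lim0]) (simp add: delay[OF s1])
      hence "(\<lambda>n. (X n (\<tau> n s) - X n s) + X n s) \<longlonglongrightarrow> 0 + L s"
        by (rule tendsto_add[OF _ Lt[OF s1]])
      hence "(\<lambda>n. X n (\<tau> n s)) \<longlonglongrightarrow> L s" by simp
      hence "(\<lambda>n. \<Phi> (X n (\<tau> n s))) \<longlonglongrightarrow> \<Phi> (L s)"
        by (rule continuous_on_tendsto_compose[OF \<Phi>]) auto
      thus ?thesis by (intro tendsto_intros)
    qed
    have "(\<lambda>n. integral {0..t} (\<lambda>s. g s - \<Phi> (X n (\<tau> n s)))) \<longlonglongrightarrow> integral {0..t} (\<lambda>s. g s - \<Phi> (L s))"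
    proof (rule dominated_convergence(2)[where h = "\<lambda>_. M"])
      show "norm (g s - \<Phi> (X n (\<tau> n s))) \<le> M" if "s \<in> {0..t}" for n s
        using bd[of s] that t by auto
      show "(\<lambda>s. g s - \<Phi> (X n (\<tau> n s))) integrable_on {0..t}" for n using ftc[of n] by (rule has_integral_integrable)
    qed (simp_all add: pw integrable_continuous_real)
    hence "(\<lambda>n. X n t) \<longlonglongrightarrow> integral {0..t} (\<lambda>s. g s - \<Phi> (L s))"
      by (simp only: integral_unique[OF ftc])
    thus ?thesis using LIMSEQ_unique[OF Lt[OF t]] by blast
  qed
  have "(L has_real_derivative g t - \<Phi> (L t)) (at t within {0..1})" if t: "t \<in> {0..1}" for t
    by (rule has_field_derivative_transform_within[OF integral_has_real_derivative[OF contI t], of 1])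
      (use eq t in auto)
  with L0 show ?thesis by blast
qed

text \<open>If \<open>D\<close> is nondecreasing wherever it is positive, positivity at the left end would persist up
  to the right end.\<close>

lemma nonpos_backward:
  fixes D D' :: "real \<Rightarrow> real"
  assumes ab: "a \<le> b" and cont: "continuous_on {a..b} D"
    and d: "\<And>x. a < x \<Longrightarrow> x < b \<Longrightarrow> (D has_real_derivative D' x) (at x)"
    and pos: "\<And>x. a < x \<Longrightarrow> x < b \<Longrightarrow> D x > 0 \<Longrightarrow> D' x \<ge> 0"
    and b: "D b \<le> 0"
  shows "D a \<le> 0"
proof (rule ccontr)
  assume "\<not> D a \<le> 0"
  hence Da: "D a > 0" by simp
  define S where "S = {x\<in>{a..b}. D x \<le> 0}"
  have "S = {a..b} \<inter> D -` {..0}" by (auto simp: S_def)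
  hence "closed S" using continuous_closed_preimage[OF cont] by auto
  moreover have "b \<in> S" using ab b by (simp add: S_def)
  moreover have bdd: "bdd_below S" unfolding S_def by (intro bdd_belowI[of _ a]) auto
  ultimately have inf: "Inf S \<in> S" using closed_contains_Inf by blast
  define m where "m = Inf S"
  have m: "a \<le> m" "m \<le> b" "D m \<le> 0" using inf by (auto simp: S_def m_def)
  have below: "D x > 0" if "a \<le> x" "x < m" for x
  proof (rule ccontr)
    assume "\<not> D x > 0"
    hence "x \<in> S" using that m by (auto simp: S_def)
    hence "m \<le> x" unfolding m_def using bdd by (rule cInf_lower)
    with that show False by simp
  qed
  have "D a \<le> D m"
  proof (rule DERIV_nonneg_imp_increasing_open[OF m(1)])
    show "\<exists>y. (D has_real_derivative y) (at x) \<and> 0 \<le> y" if "a < x" "x < m" for x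
      using d[of x] pos[of x] below[of x] that m by auto
    show "continuous_on {a..m} D" using cont m by (auto intro: continuous_on_subset)
  qed
  with m Da show False by simp
qed

section \<open>Autonomous scalar equations on the unit interval\<close>

text \<open>The signed time needed to travel from \<open>a\<close> to \<open>b\<close> at the speed \<open>h\<close>.\<close>

definition travel :: "(real \<Rightarrow> real) \<Rightarrow> real \<Rightarrow> real \<Rightarrow> real" where
  "travel h a b = (if a \<le> b then integral {a..b} (\<lambda>s. 1 / h s) else - integral {b..a} (\<lambda>s. 1 / h s))"

lemma travel_self [simp]: "travel h a a = 0"
  by (simp add: travel_def)

lemma travel_cong:
  assumes "\<And>s. min a b \<le> s \<Longrightarrow> s \<le> max a b \<Longrightarrow> h s = h' s"
  shows "travel h a b = travel h' a b"
  using assms by (auto simp: travel_def intro!: integral_cong)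

text \<open>A continuous positive speed on \<open>(0,1)\<close>; nothing is said about its values elsewhere.\<close>

locale positive_speed =
  fixes h :: "real \<Rightarrow> real"
  assumes cont_h: "continuous_on {0<..<1} h"
    and h_pos: "\<And>s. s \<in> {0<..<1} \<Longrightarrow> h s > 0"
begin

lemma primitive_exists: "\<exists>T. \<forall>x\<in>{0<..<1}. (T has_real_derivative 1 / h x) (at x)"
proof -
  have "\<exists>F. \<forall>x. ereal 0 < ereal x \<longrightarrow> ereal x < ereal 1 \<longrightarrow> (F has_vector_derivative 1 / h x) (at x)"
  proof (rule einterval_antiderivative)
    show "isCont (\<lambda>x. 1 / h x) x" if "ereal 0 < ereal x" "ereal x < ereal 1" for x
    proof -
      have x: "x \<in> {0<..<1}" using that by auto
      have "isCont h x" using cont_h x by (simp add: continuous_on_eq_continuous_at)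
      thus ?thesis using h_pos[OF x] by (intro continuous_intros) auto
    qed
  qed auto
  then obtain F where "\<And>x. 0 < x \<Longrightarrow> x < 1 \<Longrightarrow> (F has_vector_derivative 1 / h x) (at x)" by auto
  thus ?thesis by (intro exI[of _ F]) (simp add: has_real_derivative_iff_has_vector_derivative)
qed

text \<open>The travel time up to an additive constant.\<close>

definition prim :: "real \<Rightarrow> real" where
  "prim = (SOME T. \<forall>x\<in>{0<..<1}. (T has_real_derivative 1 / h x) (at x))"

lemma prim_deriv: "x \<in> {0<..<1} \<Longrightarrow> (prim has_real_derivative 1 / h x) (at x)"
  using someI_ex[OF primitive_exists] unfolding prim_def by blast

lemma travel_eq:
  assumes "a \<in> {0<..<1}" "b \<in> {0<..<1}"
  shows "travel h a b = prim b - prim a"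
proof -
  have *: "integral {a..b} (\<lambda>s. 1 / h s) = prim b - prim a"
    if "a \<le> b" "a \<in> {0<..<1}" "b \<in> {0<..<1}" for a b
  proof (intro integral_unique fundamental_theorem_of_calculus that)
    fix x assume "x \<in> {a..b}"
    hence "x \<in> {0<..<1}" using that by auto
    thus "(prim has_vector_derivative 1 / h x) (at x within {a..b})"
      using prim_deriv has_field_derivative_at_within has_real_derivative_iff_has_vector_derivative
      by blast
  qed
  show ?thesis using *[of a b] *[of b a] assms by (simp add: travel_def)
qed

lemma prim_less:
  assumes "0 < a" "a < b" "b < 1"
  shows "prim a < prim b"
proof (rule DERIV_pos_imp_increasing[OF assms(2)])
  fix x assume "a \<le> x" "x \<le> b"
  thus "\<exists>y. (prim has_real_derivative y) (at x) \<and> 0 < y"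
    using prim_deriv[of x] h_pos[of x] assms by (intro exI[of _ "1 / h x"]) auto
qed

lemma prim_less_iff: "a \<in> {0<..<1} \<Longrightarrow> b \<in> {0<..<1} \<Longrightarrow> prim a < prim b \<longleftrightarrow> a < b"
  using prim_less[of a b] prim_less[of b a] by (cases a b rule: linorder_cases) auto

lemma travel_add:
  assumes "a \<in> {0<..<1}" "b \<in> {0<..<1}" "c \<in> {0<..<1}"
  shows "travel h a b + travel h b c = travel h a c"
  using assms by (simp add: travel_eq)

lemma travel_pos:
  assumes "0 < a" "a < b" "b < 1"
  shows "travel h a b > 0"
  using assms prim_less[of a b] by (simp add: travel_eq)

end

text \<open>If the speed is at most linear at the two ends, the solutions of \<open>w' = h w\<close> inside \<open>(0,1)\<close> run from \<open>0\<close> to \<open>1\<close>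
  without reaching either of them.\<close>

locale front_speed = positive_speed h for h :: "real \<Rightarrow> real" +
  fixes K :: real
  assumes K_pos: "K > 0"
    and h_le0: "\<And>s. s \<in> {0..1} \<Longrightarrow> h s \<le> K * s"
    and h_le1: "\<And>s. s \<in> {0..1} \<Longrightarrow> h s \<le> K * (1 - s)"
begin

lemma prim_le_near_0:
  assumes "0 < x" "x \<le> c" "c < 1"
  shows "prim x \<le> prim c + (ln x - ln c) / K"
proof -
  have "prim x - ln x / K \<le> prim c - ln c / K"
  proof (rule DERIV_nonneg_imp_nondecreasing[OF assms(2)])
    fix y assume y: "x \<le> y" "y \<le> c"
    hence y1: "y \<in> {0<..<1}" using assms by auto
    have "((\<lambda>x. prim x - ln x / K) has_real_derivative (1 / h y - 1 / y / K)) (at y)"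
      using y1 K_pos by (auto intro!: derivative_eq_intros prim_deriv)
    moreover have "1 / y / K \<le> 1 / h y"
      using h_pos[OF y1] h_le0[of y] y1 K_pos by (auto simp: field_simps)
    ultimately show "\<exists>z. ((\<lambda>x. prim x - ln x / K) has_real_derivative z) (at y) \<and> 0 \<le> z"
      by force
  qed
  thus ?thesis by (simp add: diff_divide_distrib)
qed

lemma prim_ge_near_1:
  assumes "0 < c" "c \<le> x" "x < 1"
  shows "prim x \<ge> prim c + (ln (1 - c) - ln (1 - x)) / K"
proof -
  have "prim c + ln (1 - c) / K \<le> prim x + ln (1 - x) / K"
  proof (rule DERIV_nonneg_imp_nondecreasing[OF assms(2)])
    fix y assume y: "c \<le> y" "y \<le> x"
    hence y1: "y \<in> {0<..<1}" using assms by auto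
    have "((\<lambda>x. prim x + ln (1 - x) / K) has_real_derivative (1 / h y - 1 / (1 - y) / K)) (at y)"
      by (rule derivative_eq_intros prim_deriv[OF y1] refl | use y1 K_pos in simp)+
    moreover have "1 / (1 - y) / K \<le> 1 / h y"
      using h_pos[OF y1] h_le1[of y] y1 K_pos by (auto simp: field_simps)
    ultimately show "\<exists>z. ((\<lambda>x. prim x + ln (1 - x) / K) has_real_derivative z) (at y) \<and> 0 \<le> z"
      by force
  qed
  thus ?thesis by (simp add: diff_divide_distrib)
qed

text \<open>By the two logarithmic bounds every time is attained.\<close>

lemma prim_surj: "\<exists>x\<in>{0<..<1}. prim x = t"
proof -
  define a where "a = min (1/2) (exp (K * (t - prim (1/2)) + ln (1/2)))"
  have a: "0 < a" "a \<le> 1/2" by (auto simp: a_def)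
  have "ln a \<le> K * (t - prim (1/2)) + ln (1/2)"
  proof -
    have "a \<le> exp (K * (t - prim (1/2)) + ln (1/2))" by (simp add: a_def)
    thus ?thesis using a by (metis exp_gt_zero ln_exp ln_le_cancel_iff)
  qed
  hence "(ln a - ln (1/2)) / K \<le> t - prim (1/2)" using K_pos by (simp add: field_simps)
  hence pa: "prim a \<le> t" using prim_le_near_0[of a "1/2"] a by simp
  define b where "b = 1 - min (1/2) (exp (ln (1/2) - K * (t - prim (1/2))))"
  have b: "1/2 \<le> b" "b < 1" by (auto simp: b_def)
  have "ln (1 - b) \<le> ln (1/2) - K * (t - prim (1/2))"
  proof -
    have "1 - b \<le> exp (ln (1/2) - K * (t - prim (1/2)))" by (simp add: b_def)
    thus ?thesis using b by (metis exp_gt_zero diff_gt_0_iff_gt ln_exp ln_le_cancel_iff)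
  qed
  hence "t - prim (1/2) \<le> (ln (1 - 1/2) - ln (1 - b)) / K" using K_pos by (simp add: field_simps)
  hence pb: "t \<le> prim b" using prim_ge_near_1[of "1/2" b] b by simp
  have "\<exists>x. a \<le> x \<and> x \<le> b \<and> prim x = t"
    using a b by (intro IVT pa pb) (auto intro!: DERIV_isCont prim_deriv)
  thus ?thesis using a b by force
qed

text \<open>The solution through \<open>v\<^sub>0\<close> at time \<open>z\<^sub>0\<close> inverts the travel time.\<close>

definition flow :: "real \<Rightarrow> real \<Rightarrow> real \<Rightarrow> real" where
  "flow z0 v0 z = (THE x. x \<in> {0<..<1} \<and> prim x = prim v0 + (z - z0))"

lemma flow:
  "flow z0 v0 z \<in> {0<..<1}" "prim (flow z0 v0 z) = prim v0 + (z - z0)"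
proof -
  obtain x where x: "x \<in> {0<..<1}" "prim x = prim v0 + (z - z0)" using prim_surj by blast
  have "flow z0 v0 z = x" unfolding flow_def
  proof (rule the_equality)
    show "y = x" if "y \<in> {0<..<1} \<and> prim y = prim v0 + (z - z0)" for y
      using that x prim_less_iff[of x y] prim_less_iff[of y x] by force
  qed (use x in blast)
  with x show "flow z0 v0 z \<in> {0<..<1}" "prim (flow z0 v0 z) = prim v0 + (z - z0)" by auto
qed

lemma flow_init: "v0 \<in> {0<..<1} \<Longrightarrow> flow z0 v0 z0 = v0"
  using flow[of z0 v0 z0] prim_less_iff[of v0 "flow z0 v0 z0"] prim_less_iff[of "flow z0 v0 z0" v0]
  by force

lemma flow_mono: "z \<le> z' \<Longrightarrow> flow z0 v0 z \<le> flow z0 v0 z'"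
  using prim_less_iff[OF flow(1)[of z0 v0 z'] flow(1)[of z0 v0 z]] flow(2)[of z0 v0] by force

lemma flow_travel:
  assumes "v0 \<in> {0<..<1}" "x \<in> {0<..<1}"
  shows "flow z0 v0 (z0 + travel h v0 x) = x"
  using assms flow[of z0 v0 "z0 + travel h v0 x"] prim_less_iff[of x "flow z0 v0 (z0 + travel h v0 x)"]
    prim_less_iff[of "flow z0 v0 (z0 + travel h v0 x)" x] by (force simp: travel_eq)

lemma flow_less: "z < z' \<Longrightarrow> flow z0 v0 z < flow z0 v0 z'"
  using prim_less_iff[OF flow(1)[of z0 v0 z] flow(1)[of z0 v0 z']] flow(2)[of z0 v0] by force

lemma flow_deriv: "(flow z0 v0 has_real_derivative h (flow z0 v0 z)) (at z)"
proof -
  let ?w = "flow z0 v0"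
  have cont: "isCont ?w z"
  proof -
    have "continuous_on {z - 1..z + 1} ?w"
    proof -
      have "continuous_on {?w (z - 1)..?w (z + 1)} (\<lambda>x. prim x - prim v0 + z0)"
        using flow(1)[of z0 v0 "z - 1"] flow(1)[of z0 v0 "z + 1"]
        by (intro continuous_intros continuous_at_imp_continuous_on ballI DERIV_isCont[OF prim_deriv]) auto
      hence "continuous_on ((\<lambda>x. prim x - prim v0 + z0) ` {?w (z - 1)..?w (z + 1)}) ?w"
      proof (rule continuous_on_inv[OF _ compact_Icc], intro ballI)
        fix x assume x: "x \<in> {?w (z - 1)..?w (z + 1)}"
        hence x1: "x \<in> {0<..<1}" using flow(1)[of z0 v0 "z - 1"] flow(1)[of z0 v0 "z + 1"] by auto
        let ?y = "?w (prim x - prim v0 + z0)"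
        have "prim ?y = prim x" using flow(2)[of z0 v0 "prim x - prim v0 + z0"] by simp
        thus "?y = x"
          using prim_less_iff[OF x1 flow(1)[of z0 v0 "prim x - prim v0 + z0"]]
            prim_less_iff[OF flow(1)[of z0 v0 "prim x - prim v0 + z0"] x1] by force
      qed
      moreover have "{z - 1..z + 1} \<subseteq> (\<lambda>x. prim x - prim v0 + z0) ` {?w (z - 1)..?w (z + 1)}"
      proof
        fix y assume y: "y \<in> {z - 1..z + 1}"
        show "y \<in> (\<lambda>x. prim x - prim v0 + z0) ` {?w (z - 1)..?w (z + 1)}"
          using y flow_mono[of "z - 1" y z0 v0] flow_mono[of y "z + 1" z0 v0] flow(2)[of z0 v0 y]
          by (intro image_eqI[of _ _ "?w y"]) auto
      qed
      ultimately show ?thesis by (rule continuous_on_subset)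
    qed
    thus ?thesis by (rule continuous_on_interior) auto
  qed
  have pos: "h (?w z) > 0" using h_pos[OF flow(1)] .
  have "(?w has_real_derivative inverse (1 / h (?w z))) (at z)"
  proof (rule DERIV_inverse_function[where f = "\<lambda>x. prim x - prim v0 + z0" and a = "z - 1" and b = "z + 1"])
    show "((\<lambda>x. prim x - prim v0 + z0) has_real_derivative 1 / h (?w z)) (at (?w z))"
      by (rule derivative_eq_intros prim_deriv flow(1) refl)+ simp
  qed (use pos cont flow(2)[of z0 v0] in auto)
  thus ?thesis by simp
qed

lemma flow_tendsto:
  "(flow z0 v0 \<longlongrightarrow> 0) at_bot" "(flow z0 v0 \<longlongrightarrow> 1) at_top"
proof -
  let ?w = "flow z0 v0"
  have inv: "?w (prim x - prim v0 + z0) = x" if "x \<in> {0<..<1}" for x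
    using flow[of z0 v0 "prim x - prim v0 + z0"] that
      prim_less_iff[of x "?w (prim x - prim v0 + z0)"] prim_less_iff[of "?w (prim x - prim v0 + z0)" x]
    by force
  have w01: "?w z > 0" "?w z < 1" for z using flow(1)[of z0 v0 z] by auto
  show "(?w \<longlongrightarrow> 0) at_bot"
  proof (rule order_tendstoI)
    show "eventually (\<lambda>z. ?w z > a) at_bot" if "a < 0" for a
      using w01(1) that by (auto intro!: always_eventually intro: less_trans)
    show "eventually (\<lambda>z. ?w z < a) at_bot" if "0 < a" for a
    proof -
      define x where "x = min (a / 2) (1/2)"
      have x: "x \<in> {0<..<1}" "x < a" using that by (auto simp: x_def)
      have "?w z < a" if "z \<le> prim x - prim v0 + z0" for z
        using flow_mono[OF that, of z0 v0] inv[OF x(1)] x by simp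
      thus ?thesis unfolding eventually_at_bot_linorder by blast
    qed
  qed
  show "(?w \<longlongrightarrow> 1) at_top"
  proof (rule order_tendstoI)
    show "eventually (\<lambda>z. ?w z < a) at_top" if "1 < a" for a
      using w01(2) that by (auto intro!: always_eventually intro: less_trans)
    show "eventually (\<lambda>z. ?w z > a) at_top" if "a < 1" for a
    proof -
      define x where "x = max ((1 + a) / 2) (1/2)"
      have x: "x \<in> {0<..<1}" "a < x" using that unfolding x_def by (auto simp: less_max_iff_disj)
      have "a < ?w z" if "z \<ge> prim x - prim v0 + z0" for z
        using flow_mono[OF that, of z0 v0] inv[OF x(1)] x by simp
      thus ?thesis unfolding eventually_at_top_linorder by blast
    qed
  qed
qed

text \<open>A solution that is somewhere inside \<open>(0,1)\<close> stays there, by the linear bounds on \<open>h\<close>; hence it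
  is the one obtained by quadrature.\<close>

lemma flow_unique:
  assumes w01: "\<And>z. w z \<in> {0..1}" and w: "\<And>z. (w has_real_derivative h (w z)) (at z)"
    and h0: "\<And>s. s \<in> {0..1} \<Longrightarrow> h s \<ge> 0"
    and init: "w z0 = v0" "v0 \<in> {0<..<1}"
  shows "w = flow z0 v0"
proof -
  have mono: "w a \<le> w b" if "a \<le> b" for a b
    using that by (rule DERIV_nonneg_imp_nondecreasing) (use w h0[OF w01] in blast)
  have pos: "w z > 0" for z
  proof (cases "z0 \<le> z")
    case True
    thus ?thesis using mono[OF True] init by auto
  next
    case False
    have "exp (- K * z) * w z \<ge> exp (- K * z0) * w z0"
    proof (rule DERIV_nonpos_imp_nonincreasing[where f = "\<lambda>z. exp (- K * z) * w z" and a = z and b = z0])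
      fix x
      have "((\<lambda>z. exp (- K * z) * w z) has_real_derivative exp (- K * x) * (h (w x) - K * w x)) (at x)"
        by (rule derivative_eq_intros w refl)+ (simp add: algebra_simps)
      moreover have "exp (- K * x) * (h (w x) - K * w x) \<le> 0"
        using h_le0[OF w01[of x]] by (intro mult_nonneg_nonpos) auto
      ultimately show "\<exists>y. ((\<lambda>z. exp (- K * z) * w z) has_real_derivative y) (at x) \<and> y \<le> 0" by blast
    qed (use False in simp)
    moreover have "exp (- K * z0) * w z0 > 0" using init by simp
    ultimately have "exp (- K * z) * w z > 0" by linarith
    thus ?thesis by (simp add: zero_less_mult_iff)
  qed
  have less1: "w z < 1" for z
  proof (cases "z \<le> z0")
    case True
    thus ?thesis using mono[OF True] init by auto
  next
    case False
    have "exp (K * z0) * (1 - w z0) \<le> exp (K * z) * (1 - w z)"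
    proof (rule DERIV_nonneg_imp_nondecreasing[where f = "\<lambda>z. exp (K * z) * (1 - w z)" and a = z0 and b = z])
      fix x
      have "((\<lambda>z. exp (K * z) * (1 - w z)) has_real_derivative exp (K * x) * (K * (1 - w x) - h (w x))) (at x)"
        by (rule derivative_eq_intros w refl)+ (simp add: algebra_simps)
      moreover have "exp (K * x) * (K * (1 - w x) - h (w x)) \<ge> 0"
        using h_le1[OF w01[of x]] by (intro mult_nonneg_nonneg) auto
      ultimately show "\<exists>y. ((\<lambda>z. exp (K * z) * (1 - w z)) has_real_derivative y) (at x) \<and> 0 \<le> y" by blast
    qed (use False in simp)
    moreover have "exp (K * z0) * (1 - w z0) > 0" using init by simp
    ultimately have "exp (K * z) * (1 - w z) > 0" by linarith
    thus ?thesis by (simp add: zero_less_mult_iff)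
  qed
  have in01: "w z \<in> {0<..<1}" for z using pos less1 by simp
  have "((\<lambda>z. prim (w z) - z) has_real_derivative 0) (at z)" for z
  proof -
    have "((\<lambda>z. prim (w z)) has_real_derivative 1 / h (w z) * h (w z)) (at z)"
      by (rule DERIV_chain2[OF prim_deriv[OF in01] w])
    thus ?thesis using h_pos[OF in01[of z]] by (auto intro!: derivative_eq_intros)
  qed
  hence eq: "prim (w z) - z = prim (w z0) - z0" for z
    using DERIV_isconst_all by blast
  show ?thesis
  proof
    fix z
    have "prim (w z) = prim (flow z0 v0 z)" using eq[of z] flow(2)[of z0 v0 z] init by simp
    thus "w z = flow z0 v0 z"
      using prim_less_iff[OF in01[of z] flow(1)[of z0 v0 z]] prim_less_iff[OF flow(1)[of z0 v0 z] in01[of z]]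
      by force
  qed
qed

end

section \<open>The slope as a function of the energy\<close>

text \<open>If \<open>y = \<epsilon> (1 / sqrt (1 - p\<^sup>2) - 1)\<close> with \<open>0 \<le> p < 1\<close>, then \<open>p = slope \<epsilon> y\<close>. The value for
  negative \<open>y\<close> is \<open>0\<close>, which makes the function monotone and continuous on the whole line.\<close>

definition slope :: "real \<Rightarrow> real \<Rightarrow> real" where
  "slope \<epsilon> y = sqrt (1 - (\<epsilon> / (\<epsilon> + max 0 y))\<^sup>2)"

text \<open>The relativistic kinetic energy of the velocity \<open>p\<close>, with \<open>\<epsilon>\<close> as mass.\<close>

definition energy :: "real \<Rightarrow> real \<Rightarrow> real" where
  "energy \<epsilon> p = \<epsilon> * (1 / sqrt (1 - p\<^sup>2) - 1)"

context
  fixes \<epsilon> :: real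
  assumes eps: "\<epsilon> > 0"
begin

lemma ratio_bounds: "0 < \<epsilon> / (\<epsilon> + max 0 y)" "\<epsilon> / (\<epsilon> + max 0 y) \<le> 1"
  using eps by auto

lemma ratio_sq: "0 < (\<epsilon> / (\<epsilon> + max 0 y))\<^sup>2" "(\<epsilon> / (\<epsilon> + max 0 y))\<^sup>2 \<le> 1"
  using ratio_bounds[of y] by (auto simp: power_le_one)

lemma slope_nonneg: "0 \<le> slope \<epsilon> y"
  using ratio_sq[of y] by (simp add: slope_def)

lemma slope_less_1: "slope \<epsilon> y < 1"
  using ratio_sq[of y] by (simp add: slope_def)

lemma slope_le_0 [simp]: "y \<le> 0 \<Longrightarrow> slope \<epsilon> y = 0"
  using eps by (simp add: slope_def)

lemma slope_mono: "x \<le> y \<Longrightarrow> slope \<epsilon> x \<le> slope \<epsilon> y"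
  using eps unfolding slope_def
  by (intro real_sqrt_le_mono diff_left_mono power_mono divide_left_mono) auto

lemma slope_pos: "y > 0 \<Longrightarrow> slope \<epsilon> y > 0"
proof -
  assume y: "y > 0"
  have "\<epsilon> / (\<epsilon> + y) < 1" using eps y by simp
  hence "(\<epsilon> / (\<epsilon> + y))\<^sup>2 < 1" using eps y by (simp add: power_less_one_iff abs_square_less_1)
  thus ?thesis using y by (simp add: slope_def)
qed

lemma slope_continuous: "continuous_on UNIV (slope \<epsilon>)"
proof -
  have "\<epsilon> + max 0 y \<noteq> 0" for y using eps by (auto simp: max_def)
  thus ?thesis unfolding slope_def[abs_def] by (intro continuous_intros) auto
qed

lemma slope_deriv:
  assumes "y > 0"
  shows "(slope \<epsilon> has_real_derivative \<epsilon>\<^sup>2 / ((\<epsilon> + y) ^ 3 * slope \<epsilon> y)) (at y)"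
proof -
  have *: "((\<lambda>y. sqrt (1 - (\<epsilon> / (\<epsilon> + y))\<^sup>2)) has_real_derivative
      \<epsilon>\<^sup>2 / ((\<epsilon> + y) ^ 3 * slope \<epsilon> y)) (at y)"
  proof -
    have p: "1 - (\<epsilon> / (\<epsilon> + y))\<^sup>2 > 0" using slope_pos[OF assms] assms by (simp add: slope_def)
    have s: "slope \<epsilon> y = sqrt (1 - (\<epsilon> / (\<epsilon> + y))\<^sup>2)" using assms by (simp add: slope_def)
    have w: "\<epsilon> + y \<noteq> 0" using eps assms by simp
    have "((\<lambda>y. \<epsilon> / (\<epsilon> + y)) has_real_derivative - (\<epsilon> / (\<epsilon> + y)\<^sup>2)) (at y)"
      by (rule derivative_eq_intros refl w)+ (simp add: power2_eq_square)
    from DERIV_diff[OF DERIV_const[of 1] DERIV_power[OF this, of 2]]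
    have "((\<lambda>y. 1 - (\<epsilon> / (\<epsilon> + y))\<^sup>2) has_real_derivative 2 * (\<epsilon>\<^sup>2 / (\<epsilon> + y) ^ 3)) (at y)"
    proof (rule DERIV_cong)
      have "0 - real 2 * (- (\<epsilon> / w\<^sup>2) * (\<epsilon> / w) ^ (2 - Suc 0)) = 2 * (\<epsilon>\<^sup>2 / w ^ 3)" for w
        by (simp add: power2_eq_square power3_eq_cube)
      thus "0 - real 2 * (- (\<epsilon> / (\<epsilon> + y)\<^sup>2) * (\<epsilon> / (\<epsilon> + y)) ^ (2 - Suc 0)) = 2 * (\<epsilon>\<^sup>2 / (\<epsilon> + y) ^ 3)" .
    qed
    from DERIV_chain2[OF DERIV_real_sqrt[OF p] this]
    show ?thesis unfolding s by (simp add: field_simps)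
  qed
  show ?thesis
    by (rule has_field_derivative_transform_within[OF *, of y])
      (use assms in \<open>auto simp: slope_def dist_real_def\<close>)
qed

lemma slope_le_sqrt: "y \<ge> 0 \<Longrightarrow> slope \<epsilon> y \<le> sqrt (2 / \<epsilon>) * sqrt y"
proof -
  assume y: "y \<ge> 0"
  define q where "q = \<epsilon> / (\<epsilon> + y)"
  have q: "1 - q = y / (\<epsilon> + y)" using eps y by (simp add: q_def field_simps)
  have "1 - q\<^sup>2 = 2 * (1 - q) - (1 - q)\<^sup>2" by (simp add: power2_eq_square algebra_simps)
  also have "\<dots> \<le> 2 * (1 - q)" by simp
  also have "\<dots> \<le> 2 / \<epsilon> * y" unfolding q using eps y by (simp add: frac_le)
  finally have "sqrt (1 - q\<^sup>2) \<le> sqrt (2 / \<epsilon> * y)" by (rule real_sqrt_le_mono)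
  moreover have "slope \<epsilon> y = sqrt (1 - q\<^sup>2)" using y by (simp add: slope_def q_def)
  ultimately show ?thesis by (simp only: real_sqrt_mult)
qed

lemma slope_energy:
  assumes "0 \<le> p" "p < 1"
  shows "slope \<epsilon> (energy \<epsilon> p) = p"
proof -
  have p2: "p\<^sup>2 < 1" using assms by (simp add: abs_square_less_1)
  have s: "0 < sqrt (1 - p\<^sup>2)" "sqrt (1 - p\<^sup>2) \<le> 1" using p2 by auto
  have "energy \<epsilon> p \<ge> 0" using eps s by (simp add: energy_def)
  hence "\<epsilon> + max 0 (energy \<epsilon> p) = \<epsilon> / sqrt (1 - p\<^sup>2)"
    by (simp add: energy_def algebra_simps)
  hence "\<epsilon> / (\<epsilon> + max 0 (energy \<epsilon> p)) = sqrt (1 - p\<^sup>2)" using eps s by simp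
  thus ?thesis using assms p2 by (simp add: slope_def)
qed

lemma energy_nonneg: "\<bar>p\<bar> < 1 \<Longrightarrow> 0 \<le> energy \<epsilon> p"
  using eps by (simp add: energy_def abs_square_less_1)

lemma energy_less:
  assumes "0 \<le> p" "p < slope \<epsilon> d"
  shows "energy \<epsilon> p < d"
proof (rule ccontr)
  assume "\<not> energy \<epsilon> p < d"
  hence "slope \<epsilon> d \<le> slope \<epsilon> (energy \<epsilon> p)" by (intro slope_mono) simp
  also have "\<dots> = p" using assms slope_less_1[of d] by (intro slope_energy) auto
  finally show False using assms by simp
qed

lemma slope_over_sqrt: "y \<ge> 0 \<Longrightarrow> slope \<epsilon> y / sqrt (1 - (slope \<epsilon> y)\<^sup>2) = (\<epsilon> + y) / \<epsilon> * slope \<epsilon> y"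
proof -
  assume y: "y \<ge> 0"
  have "(slope \<epsilon> y)\<^sup>2 = 1 - (\<epsilon> / (\<epsilon> + y))\<^sup>2" using ratio_sq(2)[of y] y by (simp add: slope_def)
  hence "sqrt (1 - (slope \<epsilon> y)\<^sup>2) = \<epsilon> / (\<epsilon> + y)" using eps y by simp
  thus ?thesis using eps by simp
qed

text \<open>The map \<open>s \<mapsto> slope \<epsilon> (a s\<^sup>2) / s\<close> is nonincreasing.\<close>

lemma slope_quadratic:
  assumes "a > 0" "0 \<le> s" "s \<le> t" "0 < t"
  shows "slope \<epsilon> (a * s\<^sup>2) \<ge> s / t * slope \<epsilon> (a * t\<^sup>2)"
proof -
  define X Y where "X = a * s\<^sup>2" and "Y = a * t\<^sup>2"
  have XY: "0 \<le> X" "X \<le> Y" "0 < Y" using assms by (auto simp: X_def Y_def intro!: mult_left_mono power_mono)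
  have st: "(s / t)\<^sup>2 = X / Y" using assms by (simp add: X_def Y_def power_divide)
  have form: "1 - (\<epsilon> / (\<epsilon> + Z))\<^sup>2 = Z * (2 * \<epsilon> + Z) / (\<epsilon> + Z)\<^sup>2" if "Z \<ge> 0" for Z
  proof -
    have "1 - (\<epsilon> / (\<epsilon> + Z))\<^sup>2 = ((\<epsilon> + Z)\<^sup>2 - \<epsilon>\<^sup>2) / (\<epsilon> + Z)\<^sup>2"
      using eps that by (simp add: power_divide diff_divide_distrib)
    also have "(\<epsilon> + Z)\<^sup>2 - \<epsilon>\<^sup>2 = Z * (2 * \<epsilon> + Z)" by (simp add: power2_eq_square algebra_simps)
    finally show ?thesis .
  qed
  have "X / Y * (1 - (\<epsilon> / (\<epsilon> + Y))\<^sup>2) \<le> 1 - (\<epsilon> / (\<epsilon> + X))\<^sup>2"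
  proof -
    have g: "(2 * \<epsilon> + Y) / (\<epsilon> + Y)\<^sup>2 \<le> (2 * \<epsilon> + X) / (\<epsilon> + X)\<^sup>2"
    proof -
      have split: "(2 * \<epsilon> + Z) / (\<epsilon> + Z)\<^sup>2 = \<epsilon> / (\<epsilon> + Z)\<^sup>2 + 1 / (\<epsilon> + Z)" if "Z \<ge> 0" for Z
      proof -
        have "(\<epsilon> + w) / w\<^sup>2 = \<epsilon> / w\<^sup>2 + 1 / w" if "w > 0" for w
          using that by (simp add: add_divide_distrib power2_eq_square)
        from this[of "\<epsilon> + Z"] show ?thesis using eps that by (simp add: add.assoc[symmetric])
      qed
      have "\<epsilon> / (\<epsilon> + Y)\<^sup>2 \<le> \<epsilon> / (\<epsilon> + X)\<^sup>2"
        using XY eps by (intro divide_left_mono power_mono) auto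
      moreover have "1 / (\<epsilon> + Y) \<le> 1 / (\<epsilon> + X)" using XY eps by (intro divide_left_mono) auto
      ultimately show ?thesis using XY by (simp add: split)
    qed
    have "X / Y * (1 - (\<epsilon> / (\<epsilon> + Y))\<^sup>2) = X * ((2 * \<epsilon> + Y) / (\<epsilon> + Y)\<^sup>2)"
      using form[of Y] XY by simp
    also have "\<dots> \<le> X * ((2 * \<epsilon> + X) / (\<epsilon> + X)\<^sup>2)" using g XY by (intro mult_left_mono) auto
    also have "\<dots> = 1 - (\<epsilon> / (\<epsilon> + X))\<^sup>2" using form[of X] XY by simp
    finally show ?thesis .
  qed
  hence "sqrt ((s / t)\<^sup>2 * (1 - (\<epsilon> / (\<epsilon> + Y))\<^sup>2)) \<le> sqrt (1 - (\<epsilon> / (\<epsilon> + X))\<^sup>2)"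
    unfolding st by (rule real_sqrt_le_mono)
  hence "s / t * sqrt (1 - (\<epsilon> / (\<epsilon> + Y))\<^sup>2) \<le> sqrt (1 - (\<epsilon> / (\<epsilon> + X))\<^sup>2)"
    using assms by (simp add: real_sqrt_mult)
  thus ?thesis using XY by (simp add: slope_def X_def Y_def)
qed

end

lemma slope_limit:
  assumes "y > 0"
  shows "((\<lambda>\<epsilon>. slope \<epsilon> y) \<longlongrightarrow> 1) (at_right 0)"
proof -
  have "((\<lambda>\<epsilon>. sqrt (1 - (\<epsilon> / (\<epsilon> + y))\<^sup>2)) \<longlongrightarrow> sqrt (1 - (0 / (0 + y))\<^sup>2)) (at_right 0)"
    using assms by (intro tendsto_intros) auto
  thus ?thesis using assms by (simp add: slope_def)
qed

section \<open>Backward orbits in the phase plane\<close>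

text \<open>A reaction term of type A that is at most linear at both equilibria.\<close>

locale reaction =
  fixes f :: "real \<Rightarrow> real" and k :: real
  assumes cont_f: "continuous_on {0..1} f"
    and f0: "f 0 = 0" and f1: "f 1 = 0"
    and k_pos: "k > 0"
    and f_le0: "\<And>s. s \<in> {0..1} \<Longrightarrow> f s \<le> k * s"
    and f_le1: "\<And>s. s \<in> {0..1} \<Longrightarrow> f s \<le> k * (1 - s)"
    and f_pos: "\<And>s. s \<in> {0<..<1} \<Longrightarrow> f s > 0"
begin

lemma f_nonneg: "s \<in> {0..1} \<Longrightarrow> 0 \<le> f s"
  using f_pos[of s] f0 f1 by (cases "s = 0 \<or> s = 1") auto

text \<open>The primitive of \<open>f\<close> that vanishes at \<open>0\<close>.\<close>

definition F :: "real \<Rightarrow> real" where "F s = integral {0..s} f"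

lemma F_0 [simp]: "F 0 = 0" by (simp add: F_def)

lemma F_deriv: "s \<in> {0..1} \<Longrightarrow> (F has_real_derivative f s) (at s within {0..1})"
  unfolding F_def by (rule integral_has_real_derivative[OF cont_f])

lemma within_01: "s \<in> {0<..<1} \<Longrightarrow> at s within {0..1} = at (s::real)"
  by (rule at_within_interior) auto

lemma F_deriv_at: "s \<in> {0<..<1} \<Longrightarrow> (F has_real_derivative f s) (at s)"
  using F_deriv[of s] within_01[of s] by auto

lemma F_cont: "continuous_on {0..1} F"
  by (rule DERIV_continuous_on) (rule F_deriv)

text \<open>The first-order problem satisfied by the energy as a function of the profile value,
  integrated backward from the equilibrium \<open>1\<close>.\<close>

definition is_orbit :: "real \<Rightarrow> real \<Rightarrow> (real \<Rightarrow> real) \<Rightarrow> bool" where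
  "is_orbit \<epsilon> c y \<longleftrightarrow> y 1 = 0 \<and>
     (\<forall>s\<in>{0..1}. (y has_real_derivative c * slope \<epsilon> (y s) - f s) (at s within {0..1}))"

text \<open>A choice of backward orbit; it exists for positive \<open>\<epsilon>\<close> and \<open>c\<close>. Its uniqueness is not needed,
  since the energy of every heteroclinic profile is shown to agree with the chosen one.\<close>

definition orbit :: "real \<Rightarrow> real \<Rightarrow> real \<Rightarrow> real" where
  "orbit \<epsilon> c = (SOME y. is_orbit \<epsilon> c y)"

lemma orbit_exists:
  assumes "\<epsilon> > 0" "c > 0"
  shows "\<exists>y. is_orbit \<epsilon> c y"
proof -
  have "\<exists>X. X 0 = 0 \<and> (\<forall>t\<in>{0..1}. (X has_real_derivative f (1 - t) - c * slope \<epsilon> (X t)) (at t within {0..1}))"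
  proof (rule monotone_ode_exists[where B = c])
    show "continuous_on {0..1} (\<lambda>t. f (1 - t))"
      by (rule continuous_on_compose2[OF cont_f]) (auto intro!: continuous_intros)
    show "continuous_on UNIV (\<lambda>x. c * slope \<epsilon> x)"
      using slope_continuous[OF assms(1)] by (intro continuous_intros)
    show "mono (\<lambda>x. c * slope \<epsilon> x)"
      using assms slope_mono by (intro monoI mult_left_mono) auto
    show "\<bar>c * slope \<epsilon> x\<bar> \<le> c" for x
      using assms slope_nonneg[of \<epsilon> x] slope_less_1[of \<epsilon> x] by (simp add: abs_mult)
  qed
  then obtain X where X0: "X 0 = 0"
    and X: "\<And>t. t \<in> {0..1} \<Longrightarrow> (X has_real_derivative f (1 - t) - c * slope \<epsilon> (X t)) (at t within {0..1})"
    by blast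
  have img: "(\<lambda>s. 1 - s) ` {0..1} = {0..1::real}"
    by (auto intro!: image_eqI[of _ _ "1 - _"])
  have "((\<lambda>s. X (1 - s)) has_real_derivative c * slope \<epsilon> (X (1 - s)) - f s) (at s within {0..1})"
    if "s \<in> {0..1}" for s
  proof -
    have "(X has_real_derivative f s - c * slope \<epsilon> (X (1 - s))) (at (1 - s) within (\<lambda>s. 1 - s) ` {0..1})"
      using X[of "1 - s"] that unfolding img by simp
    moreover have "((\<lambda>s. 1 - s) has_real_derivative -1) (at s within {0..1})"
      by (auto intro!: derivative_eq_intros)
    ultimately have "(X \<circ> (\<lambda>s. 1 - s) has_real_derivative (f s - c * slope \<epsilon> (X (1 - s))) * -1) (at s within {0..1})"
      by (rule DERIV_image_chain)
    thus ?thesis by (simp add: o_def)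
  qed
  hence "is_orbit \<epsilon> c (\<lambda>s. X (1 - s))" by (simp add: is_orbit_def X0)
  thus ?thesis by blast
qed

context
  fixes \<epsilon> c :: real
  assumes eps: "\<epsilon> > 0" and c: "c > 0"
begin

lemma orbit: "is_orbit \<epsilon> c (orbit \<epsilon> c)"
  unfolding orbit_def using orbit_exists[OF eps c] by (rule someI_ex)

lemma orbit_1: "orbit \<epsilon> c 1 = 0"
  using orbit by (simp add: is_orbit_def)

lemma orbit_deriv:
  "s \<in> {0..1} \<Longrightarrow> (orbit \<epsilon> c has_real_derivative c * slope \<epsilon> (orbit \<epsilon> c s) - f s) (at s within {0..1})"
  using orbit by (simp add: is_orbit_def)

lemma orbit_deriv_at:
  "s \<in> {0<..<1} \<Longrightarrow> (orbit \<epsilon> c has_real_derivative c * slope \<epsilon> (orbit \<epsilon> c s) - f s) (at s)"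
  using orbit_deriv[of s] within_01[of s] by auto

lemma orbit_cont: "continuous_on {0..1} (orbit \<epsilon> c)"
  by (rule DERIV_continuous_on) (rule orbit_deriv)

text \<open>Comparison with an upper barrier; the monotonicity of the slope makes it work backward.\<close>

lemma orbit_le_barrier:
  assumes s: "s \<in> {0..1}"
    and cont: "continuous_on {s..1} \<beta>"
    and d: "\<And>x. s < x \<Longrightarrow> x < 1 \<Longrightarrow> (\<beta> has_real_derivative \<beta>' x) (at x)"
    and le: "\<And>x. s < x \<Longrightarrow> x < 1 \<Longrightarrow> \<beta>' x \<le> c * slope \<epsilon> (\<beta> x) - f x"
    and end1: "\<beta> 1 \<ge> 0"
  shows "orbit \<epsilon> c s \<le> \<beta> s"
proof -
  have "orbit \<epsilon> c s - \<beta> s \<le> 0"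
  proof (rule nonpos_backward[where D = "\<lambda>x. orbit \<epsilon> c x - \<beta> x" and a = s and b = 1
      and D' = "\<lambda>x. c * slope \<epsilon> (orbit \<epsilon> c x) - f x - \<beta>' x"])
    show "continuous_on {s..1} (\<lambda>x. orbit \<epsilon> c x - \<beta> x)"
      using continuous_on_subset[OF orbit_cont, of "{s..1}"] cont s by (intro continuous_intros) auto
    show "((\<lambda>x. orbit \<epsilon> c x - \<beta> x) has_real_derivative
        c * slope \<epsilon> (orbit \<epsilon> c x) - f x - \<beta>' x) (at x)" if "s < x" "x < 1" for x
      using that s by (intro DERIV_diff orbit_deriv_at d) auto
    show "0 \<le> c * slope \<epsilon> (orbit \<epsilon> c x) - f x - \<beta>' x"
      if "s < x" "x < 1" "0 < orbit \<epsilon> c x - \<beta> x" for x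
    proof -
      have "c * slope \<epsilon> (\<beta> x) \<le> c * slope \<epsilon> (orbit \<epsilon> c x)"
        using that c by (intro mult_left_mono slope_mono eps) auto
      thus ?thesis using le[OF that(1,2)] by linarith
    qed
  qed (use s end1 orbit_1 in auto)
  thus ?thesis by simp
qed

lemma orbit_nonneg:
  assumes s: "s \<in> {0..1}"
  shows "0 \<le> orbit \<epsilon> c s"
proof -
  have "- orbit \<epsilon> c s \<le> 0"
  proof (rule nonpos_backward[where D = "\<lambda>x. - orbit \<epsilon> c x" and a = s and b = 1
      and D' = "\<lambda>x. - (c * slope \<epsilon> (orbit \<epsilon> c x) - f x)"])
    show "continuous_on {s..1} (\<lambda>x. - orbit \<epsilon> c x)"
      using continuous_on_subset[OF orbit_cont, of "{s..1}"] s by (intro continuous_intros) auto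
    show "((\<lambda>x. - orbit \<epsilon> c x) has_real_derivative - (c * slope \<epsilon> (orbit \<epsilon> c x) - f x)) (at x)"
      if "s < x" "x < 1" for x
      using that s by (intro DERIV_minus orbit_deriv_at) auto
    show "0 \<le> - (c * slope \<epsilon> (orbit \<epsilon> c x) - f x)" if "s < x" "x < 1" "0 < - orbit \<epsilon> c x" for x
      using that s eps f_nonneg[of x] by simp
  qed (use s orbit_1 in auto)
  thus ?thesis by simp
qed

lemma orbit_pos:
  assumes s: "s \<in> {0<..<1}"
  shows "0 < orbit \<epsilon> c s"
proof (rule ccontr)
  assume "\<not> 0 < orbit \<epsilon> c s"
  hence 0: "orbit \<epsilon> c s = 0" using orbit_nonneg[of s] s by auto
  have "c * slope \<epsilon> (orbit \<epsilon> c s) - f s = 0"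
  proof (rule DERIV_local_min[OF orbit_deriv_at[OF s]])
    show "0 < min s (1 - s)" using s by auto
    show "\<forall>y. \<bar>s - y\<bar> < min s (1 - s) \<longrightarrow> orbit \<epsilon> c s \<le> orbit \<epsilon> c y"
      unfolding 0 by (auto intro!: orbit_nonneg)
  qed
  thus False using 0 f_pos[OF s] eps by simp
qed

text \<open>This monotonicity, which expresses \<open>slope < 1\<close>, bounds the energy from above when integrated from
  \<open>0\<close> and from below when integrated from the right.\<close>

lemma orbit_deficit_mono:
  assumes "0 \<le> s" "s \<le> t" "t \<le> 1"
  shows "c * s - F s - orbit \<epsilon> c s \<le> c * t - F t - orbit \<epsilon> c t"
proof (rule DERIV_nonneg_imp_increasing_open[OF assms(2)])
  fix x assume x: "s < x" "x < t"
  hence "((\<lambda>s. c * s - F s - orbit \<epsilon> c s) has_real_derivative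
      c * 1 - f x - (c * slope \<epsilon> (orbit \<epsilon> c x) - f x)) (at x)"
    using assms by (intro DERIV_diff DERIV_cmult DERIV_ident F_deriv_at orbit_deriv_at) auto
  moreover have "c * slope \<epsilon> (orbit \<epsilon> c x) \<le> c * 1"
    using c slope_less_1[OF eps, of "orbit \<epsilon> c x"] by (intro mult_left_mono) auto
  ultimately show "\<exists>y. ((\<lambda>s. c * s - F s - orbit \<epsilon> c s) has_real_derivative y) (at x) \<and> 0 \<le> y"
    by (intro exI conjI) (assumption, simp)
next
  have "continuous_on {0..1} (\<lambda>s. c * s - F s - orbit \<epsilon> c s)"
    using F_cont orbit_cont by (intro continuous_intros)
  thus "continuous_on {s..t} (\<lambda>s. c * s - F s - orbit \<epsilon> c s)"
    by (rule continuous_on_subset) (use assms in auto)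
qed

lemma orbit_le_near_1:
  assumes s: "s \<in> {0..1}"
  shows "orbit \<epsilon> c s \<le> k / 2 * (1 - s)\<^sup>2"
proof (rule orbit_le_barrier[OF s])
  show "((\<lambda>s. k / 2 * (1 - s)\<^sup>2) has_real_derivative - k * (1 - x)) (at x)" for x
    by (auto intro!: derivative_eq_intros simp: field_simps)
  show "- k * (1 - x) \<le> c * slope \<epsilon> (k / 2 * (1 - x)\<^sup>2) - f x" if "s < x" "x < 1" for x
  proof -
    have "0 \<le> c * slope \<epsilon> (k / 2 * (1 - x)\<^sup>2)" using c slope_nonneg[OF eps] by simp
    thus ?thesis using f_le1[of x] that s by simp
  qed
qed (use k_pos in \<open>auto intro!: continuous_intros\<close>)

lemma orbit_le_near_0:
  assumes s: "s \<in> {0..1}" and 0: "orbit \<epsilon> c 0 = 0"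
  shows "sqrt (orbit \<epsilon> c s) \<le> c / sqrt (2 * \<epsilon>) * s"
proof -
  have "sqrt (orbit \<epsilon> c s) - c / sqrt (2 * \<epsilon>) * s \<le> sqrt (orbit \<epsilon> c 0) - c / sqrt (2 * \<epsilon>) * 0"
  proof (rule DERIV_nonpos_imp_decreasing_open[where a = 0 and b = s])
    show "0 \<le> s" using s by simp
    show "continuous_on {0..s} (\<lambda>s. sqrt (orbit \<epsilon> c s) - c / sqrt (2 * \<epsilon>) * s)"
      using continuous_on_subset[OF orbit_cont, of "{0..s}"] s by (intro continuous_intros) auto
  next
    fix x assume "0 < x" "x < s"
    hence x: "x \<in> {0<..<1}" using s by auto
    define y where "y = orbit \<epsilon> c x"
    have y: "y > 0" using orbit_pos[OF x] by (simp add: y_def)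
    have d: "((\<lambda>s. sqrt (orbit \<epsilon> c s) - c / sqrt (2 * \<epsilon>) * s) has_real_derivative
        (inverse (sqrt y) / 2 * (c * slope \<epsilon> y - f x) - c / sqrt (2 * \<epsilon>) * 1)) (at x)"
      using y orbit_deriv_at[OF x] unfolding y_def
      by (intro DERIV_diff DERIV_cmult DERIV_ident DERIV_chain2[OF DERIV_real_sqrt])
    have "c * slope \<epsilon> y - f x \<le> c * (sqrt (2 / \<epsilon>) * sqrt y)"
    proof -
      have "c * slope \<epsilon> y \<le> c * (sqrt (2 / \<epsilon>) * sqrt y)"
        using c slope_le_sqrt[OF eps, of y] y by (intro mult_left_mono) auto
      thus ?thesis using f_pos[OF x] by linarith
    qed
    hence "inverse (sqrt y) / 2 * (c * slope \<epsilon> y - f x) \<le> inverse (sqrt y) / 2 * (c * (sqrt (2 / \<epsilon>) * sqrt y))"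
      using y by (intro mult_left_mono) auto
    also have "\<dots> = c * (sqrt (2 / \<epsilon>) / 2)" using y by (simp add: field_simps)
    also have "sqrt (2 / \<epsilon>) / 2 = 1 / sqrt (2 * \<epsilon>)"
      using eps by (simp add: real_sqrt_divide real_sqrt_mult field_simps)
    finally show "\<exists>z. ((\<lambda>s. sqrt (orbit \<epsilon> c s) - c / sqrt (2 * \<epsilon>) * s) has_real_derivative z) (at x) \<and> z \<le> 0"
      using d by (intro exI conjI) (assumption, simp)
  qed
  thus ?thesis using 0 by simp
qed

text \<open>When the orbit also ends at the equilibrium \<open>0\<close>, it is the phase portrait of a front.\<close>

lemma front_speed_orbit:
  assumes 0: "orbit \<epsilon> c 0 = 0"
  shows "front_speed (\<lambda>s. slope \<epsilon> (orbit \<epsilon> c s)) (c / \<epsilon> + sqrt (k / \<epsilon>))"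
proof
  show "continuous_on {0<..<1} (\<lambda>s. slope \<epsilon> (orbit \<epsilon> c s))"
    by (rule continuous_on_compose2[OF slope_continuous[OF eps] continuous_on_subset[OF orbit_cont]]) auto
  show "0 < c / \<epsilon> + sqrt (k / \<epsilon>)" using c eps k_pos by (simp add: add_pos_pos)
  show "0 < slope \<epsilon> (orbit \<epsilon> c s)" if "s \<in> {0<..<1}" for s
    using slope_pos[OF eps orbit_pos[OF that]] .
  fix s :: real assume s: "s \<in> {0..1}"
  have sl: "slope \<epsilon> (orbit \<epsilon> c s) \<le> sqrt (2 / \<epsilon>) * sqrt (orbit \<epsilon> c s)"
    using slope_le_sqrt[OF eps orbit_nonneg[OF s]] .
  also have "\<dots> \<le> sqrt (2 / \<epsilon>) * (c / sqrt (2 * \<epsilon>) * s)"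
    using eps by (intro mult_left_mono orbit_le_near_0[OF s 0]) auto
  also have "\<dots> = c / \<epsilon> * s"
    using eps by (simp add: real_sqrt_divide real_sqrt_mult field_simps)
  also have "\<dots> \<le> (c / \<epsilon> + sqrt (k / \<epsilon>)) * s"
    using s eps k_pos by (intro mult_right_mono) auto
  finally show "slope \<epsilon> (orbit \<epsilon> c s) \<le> (c / \<epsilon> + sqrt (k / \<epsilon>)) * s" .
  note sl
  also have "sqrt (2 / \<epsilon>) * sqrt (orbit \<epsilon> c s) \<le> sqrt (2 / \<epsilon>) * sqrt (k / 2 * (1 - s)\<^sup>2)"
    using eps by (intro mult_left_mono real_sqrt_le_mono orbit_le_near_1[OF s]) auto
  also have "\<dots> = sqrt (2 / \<epsilon> * (k / 2)) * sqrt ((1 - s)\<^sup>2)"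
    by (simp only: real_sqrt_mult mult.assoc)
  also have "\<dots> = sqrt (k / \<epsilon>) * (1 - s)"
    using s by simp
  also have "\<dots> \<le> (c / \<epsilon> + sqrt (k / \<epsilon>)) * (1 - s)"
    using s eps c by (intro mult_right_mono) auto
  finally show "slope \<epsilon> (orbit \<epsilon> c s) \<le> (c / \<epsilon> + sqrt (k / \<epsilon>)) * (1 - s)" .
qed

end

text \<open>The speeds at which the backward orbit reaches the equilibrium \<open>0\<close>.\<close>

definition connecting :: "real \<Rightarrow> real set" where
  "connecting \<epsilon> = {c. 0 < c \<and> orbit \<epsilon> c 0 = 0}"

lemma orbit_antimono:
  assumes "\<epsilon> > 0" "0 < c" "c \<le> c'"
  shows "orbit \<epsilon> c' 0 \<le> orbit \<epsilon> c 0"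
proof (rule orbit_le_barrier[where \<beta>' = "\<lambda>x. c * slope \<epsilon> (orbit \<epsilon> c x) - f x"])
  show "c * slope \<epsilon> (orbit \<epsilon> c x) - f x \<le> c' * slope \<epsilon> (orbit \<epsilon> c x) - f x" for x
    using assms slope_nonneg[OF assms(1)] by (simp add: mult_right_mono)
qed (use assms orbit_1[OF assms(1,2)] orbit_cont[OF assms(1,2)] orbit_deriv_at[OF assms(1,2)] in auto)

text \<open>The orbit of the larger speed, lifted by \<open>(c' - c) (1 - s)\<close>, is an upper barrier for the smaller
  speed.\<close>

lemma orbit_speed_lipschitz:
  assumes "\<epsilon> > 0" "0 < c" "c \<le> c'"
  shows "orbit \<epsilon> c 0 \<le> orbit \<epsilon> c' 0 + (c' - c)"
proof -
  have c': "c' > 0" using assms by simp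
  define \<beta> where "\<beta> s = orbit \<epsilon> c' s + (c' - c) * (1 - s)" for s
  have "orbit \<epsilon> c 0 \<le> \<beta> 0"
  proof (rule orbit_le_barrier[OF assms(1,2), where \<beta>' = "\<lambda>x. c' * slope \<epsilon> (orbit \<epsilon> c' x) - f x + (c' - c) * (-1)"])
    show "continuous_on {0..1} \<beta>" unfolding \<beta>_def
      using orbit_cont[OF assms(1) c'] by (intro continuous_intros)
    fix x :: real assume x: "0 < x" "x < 1"
    show "(\<beta> has_real_derivative c' * slope \<epsilon> (orbit \<epsilon> c' x) - f x + (c' - c) * (-1)) (at x)"
      unfolding \<beta>_def using x
      by (intro DERIV_add orbit_deriv_at assms c' DERIV_cmult) (auto intro!: derivative_eq_intros)
    have "c * slope \<epsilon> (orbit \<epsilon> c' x) \<le> c * slope \<epsilon> (\<beta> x)"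
      using assms x by (intro mult_left_mono slope_mono) (auto simp: \<beta>_def)
    moreover have "(c' - c) * slope \<epsilon> (orbit \<epsilon> c' x) \<le> (c' - c) * 1"
      using assms slope_less_1[OF assms(1), of "orbit \<epsilon> c' x"] by (intro mult_left_mono) auto
    ultimately show "c' * slope \<epsilon> (orbit \<epsilon> c' x) - f x + (c' - c) * (-1) \<le> c * slope \<epsilon> (\<beta> x) - f x"
      by (simp add: algebra_simps)
  next
    show "0 \<le> \<beta> 1" using orbit_1[OF assms(1) c'] by (simp add: \<beta>_def)
  qed auto
  thus ?thesis by (simp add: \<beta>_def)
qed

lemma F_bound:
  assumes "\<epsilon> > 0" "c \<in> connecting \<epsilon>" "s \<in> {0..1}"
  shows "orbit \<epsilon> c s \<le> c * s - F s"
  using orbit_deficit_mono[of \<epsilon> c 0 s] assms by (simp add: connecting_def)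

lemma F_pos: "s \<in> {0<..1} \<Longrightarrow> F s > 0"
proof -
  assume s: "s \<in> {0<..1}"
  have "F 0 < F s"
    by (rule DERIV_pos_imp_increasing_open[where a = 0 and b = s])
      (use s f_pos F_deriv_at continuous_on_subset[OF F_cont, of "{0..s}"] in \<open>auto, fastforce\<close>)
  thus ?thesis by simp
qed

text \<open>For large speeds \<open>s \<mapsto> s\<^sup>2\<close> is an upper barrier.\<close>

lemma connecting_nonempty:
  assumes "\<epsilon> > 0"
  shows "connecting \<epsilon> \<noteq> {}"
proof -
  define r where "r = slope \<epsilon> (1 * 1\<^sup>2)"
  have r: "r > 0" using slope_pos[OF assms, of 1] by (simp add: r_def)
  define c where "c = (2 + k) / r"
  have c: "c > 0" using r k_pos by (simp add: c_def)
  have "orbit \<epsilon> c 0 \<le> 1 * 0\<^sup>2"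
  proof (rule orbit_le_barrier[OF assms c, where \<beta>' = "\<lambda>x. 2 * x"])
    fix x :: real assume x: "0 < x" "x < 1"
    have "x / 1 * r \<le> slope \<epsilon> (1 * x\<^sup>2)"
      unfolding r_def using x by (intro slope_quadratic assms) auto
    hence "c * (x * r) \<le> c * slope \<epsilon> (1 * x\<^sup>2)" using c by (intro mult_left_mono) auto
    moreover have "c * (x * r) = 2 * x + k * x" using r by (simp add: c_def field_simps)
    ultimately show "2 * x \<le> c * slope \<epsilon> (1 * x\<^sup>2) - f x" using f_le0[of x] x by simp
  qed (auto intro!: continuous_intros derivative_eq_intros)
  hence "orbit \<epsilon> c 0 = 0" using orbit_nonneg[OF assms c, of 0] by simp
  thus ?thesis using c by (auto simp: connecting_def)
qed

lemma connecting_eq: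
  assumes "\<epsilon> > 0"
  shows "Inf (connecting \<epsilon>) > 0" "connecting \<epsilon> = {Inf (connecting \<epsilon>)..}"
proof -
  define c0 where "c0 = Inf (connecting \<epsilon>)"
  have lb: "F 1 \<le> c" if "c \<in> connecting \<epsilon>" for c
    using F_bound[OF assms that, of 1] orbit_1[OF assms, of c] that by (simp add: connecting_def)
  hence bdd: "bdd_below (connecting \<epsilon>)" by (intro bdd_belowI) auto
  have "F 1 \<le> c0" unfolding c0_def
    using lb connecting_nonempty[OF assms] by (intro cInf_greatest) auto
  thus c0: "Inf (connecting \<epsilon>) > 0" using F_pos[of 1] by (simp add: c0_def)
  hence c0': "c0 > 0" by (simp add: c0_def)
  have "orbit \<epsilon> c0 0 \<le> e" if e: "e > 0" for e
  proof -
    obtain c where c: "c \<in> connecting \<epsilon>" "c < c0 + e"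
      using cInf_lessD[OF connecting_nonempty[OF assms], of "c0 + e"] e unfolding c0_def by auto
    have "c0 \<le> c" unfolding c0_def using c(1) bdd by (rule cInf_lower)
    from orbit_speed_lipschitz[OF assms c0' this] show ?thesis
      using c by (simp add: connecting_def)
  qed
  hence "orbit \<epsilon> c0 0 \<le> 0" by (rule field_le_epsilon[of _ 0, simplified])
  hence c0_0: "orbit \<epsilon> c0 0 = 0" using orbit_nonneg[OF assms c0', of 0] by simp
  have "c \<in> connecting \<epsilon>" if "c0 \<le> c" for c
    using orbit_antimono[OF assms c0' that] orbit_nonneg[OF assms, of c 0] c0_0 c0' that
    by (simp add: connecting_def)
  moreover have "c0 \<le> c" if "c \<in> connecting \<epsilon>" for c
    unfolding c0_def using that bdd by (rule cInf_lower)
  ultimately show "connecting \<epsilon> = {Inf (connecting \<epsilon>)..}" unfolding c0_def by auto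
qed

end

section \<open>Heteroclinic profiles and connecting orbits\<close>

lemma energy_derivs:
  fixes p :: "real \<Rightarrow> real"
  assumes p: "(p has_real_derivative p') (at z)" and lt: "\<bar>p z\<bar> < 1"
  shows "((\<lambda>x. p x / sqrt (1 - (p x)\<^sup>2)) has_real_derivative p' / sqrt (1 - (p z)\<^sup>2) ^ 3) (at z)"
    and "((\<lambda>x. energy \<epsilon> (p x)) has_real_derivative \<epsilon> * (p z * (p' / sqrt (1 - (p z)\<^sup>2) ^ 3))) (at z)"
proof -
  define q where "q = sqrt (1 - (p z)\<^sup>2)"
  have pos: "1 - (p z)\<^sup>2 > 0" using lt by (simp add: abs_square_less_1)
  hence q: "q > 0" "q\<^sup>2 = 1 - (p z)\<^sup>2" by (auto simp: q_def)
  have "((\<lambda>x. 1 - (p x)\<^sup>2) has_real_derivative - (2 * p z * p')) (at z)"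
    by (rule derivative_eq_intros p refl)+ simp
  from DERIV_chain2[OF DERIV_real_sqrt[OF pos] this]
  have dq: "((\<lambda>x. sqrt (1 - (p x)\<^sup>2)) has_real_derivative - (p z * p' / q)) (at z)"
    by (rule DERIV_cong) (simp add: q_def[symmetric] field_simps)
  have q0: "sqrt (1 - (p z)\<^sup>2) \<noteq> 0" using q by (simp add: q_def[symmetric])
  have "((\<lambda>x. p x / sqrt (1 - (p x)\<^sup>2)) has_real_derivative
      (p' * q - p z * - (p z * p' / q)) / (q * q)) (at z)"
    using DERIV_divide[OF p dq q0] by (simp add: q_def[symmetric])
  moreover have "(p' * q - p z * - (p z * p' / q)) / (q * q) = p' / q ^ 3"
  proof -
    have "(p' * q - p z * - (p z * p' / q)) = p' * (q\<^sup>2 + (p z)\<^sup>2) / q"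
      using q(1) by (simp add: field_simps power2_eq_square)
    also have "\<dots> = p' / q" using q(2) by simp
    finally show ?thesis by (simp add: power3_eq_cube)
  qed
  ultimately show "((\<lambda>x. p x / sqrt (1 - (p x)\<^sup>2)) has_real_derivative p' / sqrt (1 - (p z)\<^sup>2) ^ 3) (at z)"
    by (simp only: q_def[symmetric])
  have "((\<lambda>x. 1 / sqrt (1 - (p x)\<^sup>2)) has_real_derivative
      (0 * q - 1 * - (p z * p' / q)) / (q * q)) (at z)"
    using DERIV_divide[OF DERIV_const[of 1] dq q0] by (simp add: q_def[symmetric])
  hence "((\<lambda>x. 1 / sqrt (1 - (p x)\<^sup>2)) has_real_derivative p z * (p' / q ^ 3)) (at z)"
    by (rule DERIV_cong) (simp add: power3_eq_cube)
  hence "((\<lambda>x. \<epsilon> * (1 / sqrt (1 - (p x)\<^sup>2) - 1)) has_real_derivative \<epsilon> * (p z * (p' / q ^ 3) - 0)) (at z)"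
    by (intro DERIV_cmult DERIV_diff DERIV_const)
  thus "((\<lambda>x. energy \<epsilon> (p x)) has_real_derivative \<epsilon> * (p z * (p' / sqrt (1 - (p z)\<^sup>2) ^ 3))) (at z)"
    by (simp add: energy_def q_def)
qed

text \<open>The momentum \<open>p / sqrt (1 - p\<^sup>2)\<close> as a function of the energy.\<close>

lemma momentum_deriv:
  assumes eps: "\<epsilon> > 0" and y: "y > 0"
  shows "((\<lambda>y. (\<epsilon> + y) / \<epsilon> * slope \<epsilon> y) has_real_derivative 1 / (\<epsilon> * slope \<epsilon> y)) (at y)"
proof -
  define s where "s = slope \<epsilon> y"
  have s: "s > 0" "s\<^sup>2 = 1 - (\<epsilon> / (\<epsilon> + y))\<^sup>2"
    using slope_pos[OF eps y] ratio_sq(2)[OF eps, of y] y by (auto simp: s_def slope_def)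
  have "((\<lambda>y. (\<epsilon> + y) / \<epsilon>) has_real_derivative 1 / \<epsilon>) (at y)"
    by (intro DERIV_cdivide) (auto intro!: derivative_eq_intros)
  from DERIV_mult[OF this slope_deriv[OF eps y]]
  show ?thesis
  proof (rule DERIV_cong)
    define w where "w = \<epsilon> + y"
    have w: "w > 0" using eps y by (simp add: w_def)
    have "1 / \<epsilon> * s + \<epsilon>\<^sup>2 / (w ^ 3 * s) * (w / \<epsilon>) = (s\<^sup>2 + (\<epsilon> / w)\<^sup>2) / (\<epsilon> * s)"
      using w eps s(1) by (simp add: divide_simps power2_eq_square power3_eq_cube)
    also have "\<dots> = 1 / (\<epsilon> * s)" using s(2) by (simp add: w_def)
    finally show "1 / \<epsilon> * slope \<epsilon> y + \<epsilon>\<^sup>2 / ((\<epsilon> + y) ^ 3 * slope \<epsilon> y) * ((\<epsilon> + y) / \<epsilon>) =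
        1 / (\<epsilon> * slope \<epsilon> y)" by (simp add: s_def w_def)
  qed
qed

context reaction
begin

lemma cont_f_comp:
  assumes "continuous_on S v" "\<And>z. z \<in> S \<Longrightarrow> v z \<in> {0..1}"
  shows "continuous_on S (\<lambda>z. f (v z))"
  by (rule continuous_on_compose2[OF cont_f assms(1)]) (use assms(2) in auto)

text \<open>The energy of a heteroclinic profile coincides with the backward orbit of the same speed: the
  square of their difference is nondecreasing along the profile and small at suitable points
  arbitrarily far to the right. At points far to the left the energy is small too, so that the orbit
  ends at \<open>0\<close>.\<close>

lemma heteroclinic_imp_connecting:
  assumes eps: "\<epsilon> > 0" and het: "heteroclinic f \<epsilon> c v"
  shows "c \<in> connecting \<epsilon>"
    and "\<And>z. (v has_real_derivative slope \<epsilon> (orbit \<epsilon> c (v z))) (at z)"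
proof -
  define p where "p = deriv v"
  define E where "E z = energy \<epsilon> (p z)" for z
  have v01: "v z \<in> {0..1}" for z using het by (simp add: heteroclinic_def)
  have mono: "mono v" using het by (simp add: heteroclinic_def)
  have lim0: "(v \<longlongrightarrow> 0) at_bot" and lim1: "(v \<longlongrightarrow> 1) at_top"
    using het by (auto simp: heteroclinic_def)
  have plt: "\<bar>p z\<bar> < 1" for z using het by (simp add: heteroclinic_def p_def)
  have dv: "(v has_real_derivative p z) (at z)" for z
  proof -
    obtain D where "(v has_vector_derivative D z) (at z)"
      using het unfolding heteroclinic_def C1_differentiable_on_def by blast
    hence "(v has_real_derivative D z) (at z)" by (simp add: has_real_derivative_iff_has_vector_derivative)
    thus ?thesis by (simp add: p_def DERIV_imp_deriv)
  qed
  have dp: "\<exists>p'. (p has_real_derivative p') (at z)" for z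
  proof -
    obtain D where "(p has_vector_derivative D z) (at z)"
      using het unfolding heteroclinic_def C1_differentiable_on_def p_def by blast
    thus ?thesis by (auto simp: has_real_derivative_iff_has_vector_derivative)
  qed
  have p0: "p z \<ge> 0" for z
    using mono_on_imp_deriv_nonneg[of UNIV v "p z" z] mono dv by simp
  have dE: "(E has_real_derivative p z * (c * p z - f (v z))) (at z)" for z
  proof -
    obtain p' where p': "(p has_real_derivative p') (at z)" using dp by blast
    note d = energy_derivs[OF p' plt]
    have "\<epsilon> * deriv (\<lambda>x. p x / sqrt (1 - (p x)\<^sup>2)) z - c * p z + f (v z) = 0"
      using het by (simp add: heteroclinic_def p_def)
    hence "\<epsilon> * (p' / sqrt (1 - (p z)\<^sup>2) ^ 3) = c * p z - f (v z)"
      unfolding DERIV_imp_deriv[OF d(1)] by simp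
    hence "\<epsilon> * (p z * (p' / sqrt (1 - (p z)\<^sup>2) ^ 3)) = p z * (c * p z - f (v z))"
      by (metis mult.left_commute)
    thus ?thesis using d(2)[of \<epsilon>] unfolding E_def by simp
  qed
  have E0: "E z \<ge> 0" for z using energy_nonneg[OF eps plt] by (simp add: E_def)
  have slopeE: "slope \<epsilon> (E z) = p z" for z
    using slope_energy[OF eps, of "p z"] p0[of z] plt[of z] by (simp add: E_def)
  have small: "\<exists>z. Z < z \<and> z < Z + 2 / d \<and> p z < d" if d: "d > 0" for Z d
  proof -
    obtain z where z: "Z < z" "z < Z + 2 / d" "v (Z + 2 / d) - v Z = (Z + 2 / d - Z) * p z"
      using MVT2[of Z "Z + 2 / d" v p] d dv by (auto simp: field_simps)
    have "2 / d * p z \<le> 1" using z(3) v01[of "Z + 2 / d"] v01[of Z] by simp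
    hence "p z < d" using d by (simp add: field_simps)
    thus ?thesis using z by blast
  qed
  have smallE: "\<exists>z. Z < z \<and> E z < d" "\<exists>z. z < Z \<and> E z < d" if d: "d > 0" for Z d
  proof -
    have s: "slope \<epsilon> d > 0" using slope_pos[OF eps d] .
    have "E z < d" if "p z < slope \<epsilon> d" for z
      unfolding E_def using energy_less[OF eps p0 that] .
    thus "\<exists>z. Z < z \<and> E z < d" "\<exists>z. z < Z \<and> E z < d"
      using small[OF s, of Z] small[OF s, of "Z - 2 / slope \<epsilon> d"] by auto
  qed
  \<comment> \<open>for \<open>c \<le> 0\<close> the energy is nonincreasing along the profile, yet small far to the left\<close>
  have c: "c > 0"
  proof (rule ccontr)
    assume "\<not> c > 0"
    have neg: "p z * (c * p z - f (v z)) \<le> 0" for z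
    proof (rule mult_nonneg_nonpos[OF p0])
      have "c * p z \<le> 0" using p0[of z] \<open>\<not> c > 0\<close> by (intro mult_nonpos_nonneg) auto
      thus "c * p z - f (v z) \<le> 0" using f_nonneg[OF v01[of z]] by linarith
    qed
    have dec: "E b \<le> E a" if "a \<le> b" for a b
      by (rule DERIV_nonpos_imp_nonincreasing[OF that]) (use dE neg in blast)
    have "p z = 0" for z
    proof (rule ccontr)
      assume "p z \<noteq> 0"
      hence "E z > 0" using slopeE[of z] E0[of z] eps by (cases "E z = 0") auto
      then obtain z' where "z' < z" "E z' < E z" using smallE(2) by blast
      thus False using dec[of z' z] by simp
    qed
    hence "v z = v 0" for z using DERIV_isconst_all[of v z 0] dv by metis
    hence "v = (\<lambda>_. v 0)" by blast
    hence "v 0 = 0" "v 0 = 1"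
      using lim0 lim1 tendsto_const_iff[of "at_bot :: real filter"] tendsto_const_iff[of "at_top :: real filter"]
      by (metis trivial_limit_at_bot_linorder, metis trivial_limit_at_top_linorder)
    thus False by simp
  qed
  define y where "y = orbit \<epsilon> c"
  have y0: "y s \<ge> 0" if "s \<in> {0..1}" for s unfolding y_def using orbit_nonneg[OF eps c that] .
  have dy: "((\<lambda>z. y (v z)) has_real_derivative (c * slope \<epsilon> (y (v z)) - f (v z)) * p z) (at z)" for z
  proof -
    have "(y has_real_derivative c * slope \<epsilon> (y (v z)) - f (v z)) (at (v z) within range v)"
      unfolding y_def by (rule DERIV_subset[OF orbit_deriv[OF eps c v01]]) (use v01 in auto)
    from DERIV_image_chain[OF this dv] show ?thesis by (simp add: o_def)
  qed
  have ycomp: "((\<lambda>z. y (v z)) \<longlongrightarrow> y s) G" if "(v \<longlongrightarrow> s) G" "s \<in> {0..1}" for s and G :: "real filter"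
    using continuous_on_tendsto_compose[OF orbit_cont[OF eps c] that] v01 by (simp add: y_def)
  define D where "D z = E z - y (v z)" for z
  have dD: "((\<lambda>z. (D z)\<^sup>2) has_real_derivative
      2 * D z * (c * p z * (slope \<epsilon> (E z) - slope \<epsilon> (y (v z))))) (at z)" for z
  proof -
    have "(D has_real_derivative c * p z * (slope \<epsilon> (E z) - slope \<epsilon> (y (v z)))) (at z)"
      unfolding D_def by (rule DERIV_cong[OF DERIV_diff[OF dE dy]]) (simp add: slopeE algebra_simps)
    from DERIV_power[OF this, of 2] show ?thesis by (simp add: mult_ac)
  qed
  have dD0: "2 * D z * (c * p z * (slope \<epsilon> (E z) - slope \<epsilon> (y (v z)))) \<ge> 0" for z
  proof -
    have "D z * (slope \<epsilon> (E z) - slope \<epsilon> (y (v z))) \<ge> 0"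
      using slope_mono[OF eps, of "E z" "y (v z)"] slope_mono[OF eps, of "y (v z)" "E z"]
      by (cases "E z \<le> y (v z)") (auto simp: D_def intro: mult_nonpos_nonpos)
    hence "2 * (c * p z) * (D z * (slope \<epsilon> (E z) - slope \<epsilon> (y (v z)))) \<ge> 0"
      using c p0[of z] by simp
    thus ?thesis by (simp add: mult_ac)
  qed
  have Dmono: "(D a)\<^sup>2 \<le> (D b)\<^sup>2" if "a \<le> b" for a b
    by (rule DERIV_nonneg_imp_nondecreasing[OF that]) (use dD dD0 in blast)
  have Ey: "E z = y (v z)" for z
  proof (rule ccontr)
    assume "E z \<noteq> y (v z)"
    hence m: "\<bar>D z\<bar> > 0" by (simp add: D_def)
    have "((\<lambda>z. y (v z)) \<longlongrightarrow> 0) at_top"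
      using ycomp[OF lim1] orbit_1[OF eps c] by (simp add: y_def)
    from order_tendstoD(2)[OF this m]
    obtain Z where Z: "\<And>x. x \<ge> Z \<Longrightarrow> y (v x) < \<bar>D z\<bar>"
      unfolding eventually_at_top_linorder by blast
    obtain x where x: "max Z z < x" "E x < \<bar>D z\<bar>" using smallE(1)[OF m] by blast
    have "\<bar>D x\<bar> < \<bar>D z\<bar>"
      using Z[of x] x E0[of x] y0[OF v01[of x]] by (auto simp: D_def)
    hence "(D x)\<^sup>2 < (D z)\<^sup>2" by (rule power2_strict_mono)
    thus False using Dmono[of z x] x by simp
  qed
  have "y 0 = 0"
  proof (rule ccontr)
    assume "y 0 \<noteq> 0"
    hence pos: "y 0 / 2 > 0" "y 0 / 2 < y 0" using y0[of 0] by auto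
    have "eventually (\<lambda>x. y 0 / 2 < y (v x)) at_bot"
      using ycomp[OF lim0] pos(2) by (intro order_tendstoD(1)) auto
    then obtain Z where Z: "\<And>x. x \<le> Z \<Longrightarrow> y 0 / 2 < y (v x)"
      unfolding eventually_at_bot_linorder by blast
    obtain x where "x < Z" "E x < y 0 / 2" using smallE(2)[OF pos(1)] by blast
    thus False using Z[of x] Ey[of x] by simp
  qed
  thus "c \<in> connecting \<epsilon>" using c by (simp add: connecting_def y_def)
  show "(v has_real_derivative slope \<epsilon> (orbit \<epsilon> c (v z))) (at z)" for z
    using dv[of z] slopeE[of z] Ey[of z] by (simp add: y_def)
qed

text \<open>Conversely, a connecting orbit yields a profile by quadrature; it is of class \<open>C\<^sup>2\<close> because the
  energy is positive along it.\<close>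

lemma flow_heteroclinic:
  assumes eps: "\<epsilon> > 0" and conn: "c \<in> connecting \<epsilon>"
  shows "heteroclinic f \<epsilon> c (front_speed.flow (\<lambda>s. slope \<epsilon> (orbit \<epsilon> c s)) z0 v0)"
proof -
  have c: "c > 0" and o0: "orbit \<epsilon> c 0 = 0" using conn by (auto simp: connecting_def)
  interpret front_speed "\<lambda>s. slope \<epsilon> (orbit \<epsilon> c s)" "c / \<epsilon> + sqrt (k / \<epsilon>)"
    by (rule front_speed_orbit[OF eps c o0])
  define w where "w = flow z0 v0"
  define y where "y z = orbit \<epsilon> c (w z)" for z
  have w01: "w z \<in> {0<..<1}" for z unfolding w_def by (rule flow(1))
  have w01': "w z \<in> {0..1}" for z using w01[of z] by auto
  have ypos: "y z > 0" for z unfolding y_def by (rule orbit_pos[OF eps c w01])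
  have dw: "(w has_real_derivative slope \<epsilon> (y z)) (at z)" for z
    unfolding w_def y_def by (rule flow_deriv)
  hence deriv_w: "deriv w = (\<lambda>z. slope \<epsilon> (y z))" by (auto intro: DERIV_imp_deriv)
  have dy: "(y has_real_derivative (c * slope \<epsilon> (y z) - f (w z)) * slope \<epsilon> (y z)) (at z)" for z
    using DERIV_chain2[OF orbit_deriv_at[OF eps c w01] dw, of z] unfolding y_def .
  have contw: "continuous_on UNIV w" by (rule DERIV_continuous_on) (rule dw)
  have conty: "continuous_on UNIV y" by (rule DERIV_continuous_on) (rule dy)
  have contsl: "continuous_on UNIV (\<lambda>z. slope \<epsilon> (y z))"
    by (rule continuous_on_compose2[OF slope_continuous[OF eps] conty]) auto
  have contfw: "continuous_on UNIV (\<lambda>z. f (w z))" by (rule cont_f_comp[OF contw w01'])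
  have dsl: "((\<lambda>z. slope \<epsilon> (y z)) has_real_derivative
      \<epsilon>\<^sup>2 / ((\<epsilon> + y z) ^ 3 * slope \<epsilon> (y z)) * ((c * slope \<epsilon> (y z) - f (w z)) * slope \<epsilon> (y z))) (at z)" for z
    by (rule DERIV_chain2[OF slope_deriv[OF eps ypos] dy])
  have contD: "continuous_on UNIV (\<lambda>z. \<epsilon>\<^sup>2 / ((\<epsilon> + y z) ^ 3 * slope \<epsilon> (y z)) * ((c * slope \<epsilon> (y z) - f (w z)) * slope \<epsilon> (y z)))"
  proof -
    have "(\<epsilon> + y z) ^ 3 * slope \<epsilon> (y z) \<noteq> 0" for z
      using slope_pos[OF eps ypos[of z]] eps ypos[of z] by simp
    thus ?thesis by (intro continuous_intros conty contsl contfw) auto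
  qed
  have C1: "w C1_differentiable_on UNIV" unfolding C1_differentiable_on_def
    using dw contsl
    by (intro exI[of _ "\<lambda>z. slope \<epsilon> (y z)"]) (simp add: has_real_derivative_iff_has_vector_derivative)
  have C1': "deriv w C1_differentiable_on UNIV" unfolding C1_differentiable_on_def deriv_w
    using dsl[unfolded has_real_derivative_iff_has_vector_derivative] contD
    by (intro exI conjI ballI) assumption+
  have eq: "\<epsilon> * deriv (\<lambda>x. deriv w x / sqrt (1 - (deriv w x)\<^sup>2)) z - c * deriv w z + f (w z) = 0" for z
  proof -
    have "(\<lambda>x. deriv w x / sqrt (1 - (deriv w x)\<^sup>2)) = (\<lambda>x. (\<epsilon> + y x) / \<epsilon> * slope \<epsilon> (y x))"
      unfolding deriv_w using slope_over_sqrt[OF eps less_imp_le[OF ypos]] by simp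
    moreover have "((\<lambda>x. (\<epsilon> + y x) / \<epsilon> * slope \<epsilon> (y x)) has_real_derivative
        1 / (\<epsilon> * slope \<epsilon> (y z)) * ((c * slope \<epsilon> (y z) - f (w z)) * slope \<epsilon> (y z))) (at z)"
      by (rule DERIV_chain2[OF momentum_deriv[OF eps ypos] dy])
    ultimately have "deriv (\<lambda>x. deriv w x / sqrt (1 - (deriv w x)\<^sup>2)) z =
        1 / (\<epsilon> * slope \<epsilon> (y z)) * ((c * slope \<epsilon> (y z) - f (w z)) * slope \<epsilon> (y z))"
      by (simp only: DERIV_imp_deriv)
    also have "\<dots> = (c * slope \<epsilon> (y z) - f (w z)) / \<epsilon>"
      using slope_pos[OF eps ypos[of z]] by simp
    finally show ?thesis using eps by (simp add: deriv_w)
  qed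
  have "\<bar>deriv w z\<bar> < 1" for z
    unfolding deriv_w using slope_nonneg[OF eps, of "y z"] slope_less_1[OF eps, of "y z"] by simp
  moreover have "mono w" unfolding w_def by (intro monoI flow_mono)
  moreover have "(w \<longlongrightarrow> 0) at_bot" "(w \<longlongrightarrow> 1) at_top" unfolding w_def by (rule flow_tendsto)+
  ultimately have "heteroclinic f \<epsilon> c w"
    unfolding heteroclinic_def using w01' C1 C1' eq by blast
  thus ?thesis by (simp add: w_def)
qed

lemma admissible_speeds_eq:
  assumes "\<epsilon> > 0"
  shows "admissible_speeds f \<epsilon> = connecting \<epsilon>"
  unfolding admissible_speeds_def
  using heteroclinic_imp_connecting(1)[OF assms] flow_heteroclinic[OF assms] by blast

lemma critical_speed_eq:
  assumes "\<epsilon> > 0"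
  shows "critical_speed f \<epsilon> = Inf (connecting \<epsilon>)"
proof -
  have "admissible_speeds f \<epsilon> = {Inf (connecting \<epsilon>)..}"
    using admissible_speeds_eq[OF assms] connecting_eq(2)[OF assms] by simp
  thus ?thesis unfolding critical_speed_def by (auto simp: atLeast_eq_iff)
qed

lemma critical_speed:
  assumes "\<epsilon> > 0"
  shows "critical_speed f \<epsilon> > 0" "critical_speed f \<epsilon> \<in> connecting \<epsilon>"
    "c \<in> connecting \<epsilon> \<Longrightarrow> critical_speed f \<epsilon> \<le> c"
  using connecting_eq[OF assms] unfolding critical_speed_eq[OF assms] by auto

text \<open>The slope of the critical profile as a function of its value.\<close>

definition speed_profile :: "real \<Rightarrow> real \<Rightarrow> real" where
  "speed_profile \<epsilon> s = slope \<epsilon> (orbit \<epsilon> (critical_speed f \<epsilon>) s)"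

lemma front_speed_profile:
  assumes "\<epsilon> > 0"
  shows "front_speed (speed_profile \<epsilon>) (critical_speed f \<epsilon> / \<epsilon> + sqrt (k / \<epsilon>))"
proof -
  have "orbit \<epsilon> (critical_speed f \<epsilon>) 0 = 0"
    using critical_speed(2)[OF assms] by (simp add: connecting_def)
  from front_speed_orbit[OF assms critical_speed(1)[OF assms] this] show ?thesis
    by (simp add: speed_profile_def[abs_def])
qed

lemma critical_profile_eq:
  assumes eps: "\<epsilon> > 0" and v0: "v0 \<in> {0<..<1}"
  shows "critical_profile f v0 \<epsilon> = front_speed.flow (speed_profile \<epsilon>) 0 v0"
proof -
  interpret front_speed "speed_profile \<epsilon>" "critical_speed f \<epsilon> / \<epsilon> + sqrt (k / \<epsilon>)"
    by (rule front_speed_profile[OF eps])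
  note conn = critical_speed(2)[OF eps]
  show ?thesis unfolding critical_profile_def
  proof (rule the_equality)
    show "heteroclinic f \<epsilon> (critical_speed f \<epsilon>) (flow 0 v0) \<and> flow 0 v0 0 = v0"
      using flow_heteroclinic[OF eps conn] flow_init[OF v0] by (simp add: speed_profile_def[abs_def])
    fix v assume v: "heteroclinic f \<epsilon> (critical_speed f \<epsilon>) v \<and> v 0 = v0"
    show "v = flow 0 v0"
    proof (rule flow_unique)
      show "v z \<in> {0..1}" for z using v by (simp add: heteroclinic_def)
      show "(v has_real_derivative speed_profile \<epsilon> (v z)) (at z)" for z
        using heteroclinic_imp_connecting(2)[OF eps] v by (simp add: speed_profile_def)
      show "0 \<le> speed_profile \<epsilon> s" for s
        using slope_nonneg[OF eps] by (simp add: speed_profile_def)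
    qed (use v v0 in auto)
  qed
qed

end

section \<open>Unimodal reaction terms\<close>

text \<open>A continuous function that vanishes at both ends, is positive inside and has only one local
  maximum point is strictly increasing before and strictly decreasing after that point.\<close>

lemma unique_local_max_imp_unimodal:
  fixes f :: "real \<Rightarrow> real"
  assumes cont: "continuous_on {0..1} f" and f0: "f 0 = 0" and f1: "f 1 = 0"
    and pos: "\<And>s. s \<in> {0<..<1} \<Longrightarrow> f s > 0"
    and m: "m \<in> {0<..<1}"
    and unique: "\<And>x. x \<in> {0<..<1} \<Longrightarrow> local_max_point_on {0..1} f x \<Longrightarrow> x = m"
  shows "\<And>a b. 0 \<le> a \<Longrightarrow> a < b \<Longrightarrow> b \<le> m \<Longrightarrow> f a < f b"
    and "\<And>a b. m \<le> a \<Longrightarrow> a < b \<Longrightarrow> b \<le> 1 \<Longrightarrow> f b < f a"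
proof -
  show "f a < f b" if ab: "0 \<le> a" "a < b" "b \<le> m" for a b
  proof (rule ccontr)
    assume not: "\<not> f a < f b"
    obtain p where p: "p \<in> {0..b}" "\<And>x. x \<in> {0..b} \<Longrightarrow> f x \<le> f p"
      using continuous_attains_sup[of "{0..b}" f] continuous_on_subset[OF cont, of "{0..b}"] ab m by auto
    \<comment> \<open>a maximum point of \<open>f\<close> on \<open>[0, b]\<close> other than the end point \<open>b\<close>\<close>
    define q where "q = (if p = b then a else p)"
    have q: "q \<in> {0..<b}" using p ab by (auto simp: q_def)
    have max: "f x \<le> f q" if "x \<in> {0..b}" for x
      using p(2)[OF that] not by (auto simp: q_def)
    have "q \<noteq> 0" using max[of "b / 2"] pos[of "b / 2"] f0 ab m by auto
    hence q1: "q \<in> {0<..<1}" using q ab m by auto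
    have "local_max_point_on {0..1} f q"
      unfolding local_max_point_on_def
      using q q1 max by (intro conjI exI[of _ "b - q"]) auto
    hence "q = m" using unique[OF q1] by blast
    thus False using q ab by simp
  qed
  show "f b < f a" if ab: "m \<le> a" "a < b" "b \<le> 1" for a b
  proof (rule ccontr)
    assume not: "\<not> f b < f a"
    obtain p where p: "p \<in> {a..1}" "\<And>x. x \<in> {a..1} \<Longrightarrow> f x \<le> f p"
      using continuous_attains_sup[of "{a..1}" f] continuous_on_subset[OF cont, of "{a..1}"] ab m by auto
    \<comment> \<open>a maximum point of \<open>f\<close> on \<open>[a, 1]\<close> other than the end point \<open>a\<close>\<close>
    define q where "q = (if p = a then b else p)"
    have q: "q \<in> {a<..1}" using p ab by (auto simp: q_def)
    have max: "f x \<le> f q" if "x \<in> {a..1}" for x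
      using p(2)[OF that] not by (auto simp: q_def)
    have "q \<noteq> 1" using max[of "(a + 1) / 2"] pos[of "(a + 1) / 2"] f1 ab m by auto
    hence q1: "q \<in> {0<..<1}" using q ab m by auto
    have "local_max_point_on {0..1} f q"
      unfolding local_max_point_on_def
      using q q1 max by (intro conjI exI[of _ "q - a"]) auto
    hence "q = m" using unique[OF q1] by blast
    thus False using q ab by simp
  qed
qed

text \<open>A reaction term that increases strictly up to \<open>m\<close> and decreases strictly from there.\<close>

locale unimodal_reaction = reaction +
  fixes m :: real
  assumes m: "0 < m" "m < 1"
    and f_inc: "\<And>a b. 0 \<le> a \<Longrightarrow> a < b \<Longrightarrow> b \<le> m \<Longrightarrow> f a < f b"
    and f_dec: "\<And>a b. m \<le> a \<Longrightarrow> a < b \<Longrightarrow> b \<le> 1 \<Longrightarrow> f b < f a"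
begin

lemma F_mvt:
  assumes "0 \<le> a" "a < b" "b \<le> 1"
  shows "\<exists>z. a < z \<and> z < b \<and> F b - F a = (b - a) * f z"
proof -
  have d: "(F has_real_derivative f x) (at x)" if "a < x" "x < b" for x
    using F_deriv_at[of x] that assms by auto
  obtain l z where z: "a < z" "z < b" "(F has_real_derivative l) (at z)" "F b - F a = (b - a) * l"
    using MVT[of a b F] assms continuous_on_subset[OF F_cont, of "{a..b}"] d real_differentiable_def
    by (metis atLeastatMost_subset_iff)
  moreover have "l = f z" using DERIV_unique[OF z(3) d] z by blast
  ultimately show ?thesis by blast
qed

text \<open>The value to be identified as the limit of the critical speed.\<close>

abbreviation cbar :: real where "cbar \<equiv> f (v_plus f)"

text \<open>The function \<open>F s - s f s\<close> is negative on \<open>(0, m]\<close>, strictly increasing on \<open>[m, 1]\<close> and positive at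
  \<open>1\<close>, so that it has exactly one zero in \<open>(0,1)\<close>.\<close>

lemma v_plus:
  "m < v_plus f" "v_plus f < 1" "F (v_plus f) = v_plus f * cbar"
proof -
  define g where "g s = F s - s * f s" for s
  have left: "g s < 0" if s: "0 < s" "s \<le> m" for s
  proof -
    obtain z where "0 < z" "z < s" "F s - F 0 = (s - 0) * f z"
      using F_mvt[of 0 s] s m by auto
    moreover from this have "s * f z < s * f s" using s f_inc[of z s] by simp
    ultimately show ?thesis by (simp add: g_def)
  qed
  have inc: "g a < g b" if ab: "m \<le> a" "a < b" "b \<le> 1" for a b
  proof -
    obtain z where z: "a < z" "z < b" "F b - F a = (b - a) * f z"
      using F_mvt[of a b] ab m by auto
    have "(b - a) * f b < (b - a) * f z" using f_dec[of z b] z ab by simp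
    moreover have "a * f b < a * f a" using f_dec[of a b] ab m by simp
    ultimately show ?thesis using z(3) by (simp add: g_def algebra_simps)
  qed
  have "\<exists>x\<ge>m. x \<le> 1 \<and> g x = 0"
  proof (rule IVT')
    show "g m \<le> 0" using left[of m] m by simp
    show "0 \<le> g 1" using F_pos[of 1] f1 by (simp add: g_def)
    have "continuous_on {0..1} g" unfolding g_def using F_cont cont_f by (intro continuous_intros)
    thus "continuous_on {m..1} g" by (rule continuous_on_subset) (use m in auto)
  qed (use m in auto)
  then obtain x where x: "m \<le> x" "x \<le> 1" "g x = 0" by blast
  have "x \<noteq> m" using left[of m] m x by auto
  moreover have "x \<noteq> 1" using x F_pos[of 1] f1 by (auto simp: g_def)
  ultimately have x': "m < x" "x < 1" using x by auto
  have "v_plus f = x" unfolding v_plus_def F_def[symmetric]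
  proof (rule Greatest_equality)
    show "x \<in> {0<..<1} \<and> F x = x * f x" using x x' m by (simp add: g_def)
    fix y assume y: "y \<in> {0<..<1} \<and> F y = y * f y"
    hence "g y = 0" by (simp add: g_def)
    show "y \<le> x"
    proof (rule ccontr)
      assume "\<not> y \<le> x"
      hence "g x < g y" using inc[of x y] x y by auto
      thus False using x \<open>g y = 0\<close> by simp
    qed
  qed
  thus "m < v_plus f" "v_plus f < 1" "F (v_plus f) = v_plus f * cbar"
    using x x' by (auto simp: g_def)
qed

lemma v_plus_01: "0 < v_plus f" "v_plus f \<in> {0<..<1}" "v_plus f \<in> {0..1}"
  using v_plus m by auto

lemma cbar_pos: "cbar > 0"
  using f_pos v_plus_01 by blast

text \<open>The limit energy to the left of \<open>v\<^sub>+\<close>. If \<open>f s \<le> cbar\<close>, then \<open>f\<close> increases up to \<open>s\<close> and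
  \<open>F s < s f s\<close>; otherwise \<open>f > cbar\<close> between \<open>s\<close> and \<open>v\<^sub>+\<close>.\<close>

lemma limit_energy_pos:
  assumes s: "0 < s" "s < v_plus f"
  shows "cbar * s - F s > 0"
proof (cases "f s > cbar")
  case True
  obtain z where z: "s < z" "z < v_plus f" "F (v_plus f) - F s = (v_plus f - s) * f z"
    using F_mvt[of s "v_plus f"] s v_plus by auto
  have "f z > cbar"
  proof (cases "m \<le> z")
    case True
    thus ?thesis using f_dec[of z "v_plus f"] z v_plus by simp
  next
    case False
    thus ?thesis using f_inc[of s z] z s \<open>f s > cbar\<close> by simp
  qed
  hence "(v_plus f - s) * cbar < (v_plus f - s) * f z" using s by simp
  thus ?thesis using z(3) v_plus(3) by (simp add: algebra_simps)
next
  case False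
  have "s < m"
  proof (rule ccontr)
    assume "\<not> s < m"
    thus False using f_dec[of s "v_plus f"] s v_plus False by simp
  qed
  obtain z where z: "0 < z" "z < s" "F s - F 0 = (s - 0) * f z"
    using F_mvt[of 0 s] s v_plus by auto
  have "s * f z < s * cbar" using f_inc[of z s] z s False \<open>s < m\<close> by simp
  thus ?thesis using z(3) by (simp add: algebra_simps)
qed

lemma limit_energy_nonneg:
  assumes s: "s \<in> {0..1}"
  shows "cbar * s - F s \<ge> 0"
proof -
  consider "s = 0" | "0 < s" "s < v_plus f" | "s = v_plus f" | "v_plus f < s" using s by fastforce
  thus ?thesis
  proof cases
    case 2
    thus ?thesis using limit_energy_pos[of s] by simp
  next
    case 4
    obtain z where z: "v_plus f < z" "z < s" "F s - F (v_plus f) = (s - v_plus f) * f z"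
      using F_mvt[of "v_plus f" s] s 4 v_plus_01 by auto
    have "(s - v_plus f) * f z \<le> (s - v_plus f) * cbar"
      using f_dec[of "v_plus f" z] z s v_plus by (intro mult_left_mono) auto
    thus ?thesis using z(3) v_plus(3) by (simp add: algebra_simps)
  qed (use v_plus(3) in auto)
qed

section \<open>The limit of the critical speed\<close>

lemma critical_speed_ge:
  assumes "\<epsilon> > 0"
  shows "cbar \<le> critical_speed f \<epsilon>"
    and "orbit \<epsilon> (critical_speed f \<epsilon>) (v_plus f) \<le> (critical_speed f \<epsilon> - cbar) * v_plus f"
proof -
  have b: "orbit \<epsilon> (critical_speed f \<epsilon>) (v_plus f) \<le> critical_speed f \<epsilon> * v_plus f - F (v_plus f)"
    by (rule F_bound[OF assms critical_speed(2)[OF assms] v_plus_01(3)])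
  thus b': "orbit \<epsilon> (critical_speed f \<epsilon>) (v_plus f) \<le> (critical_speed f \<epsilon> - cbar) * v_plus f"
    using v_plus(3) by (simp add: algebra_simps)
  have "0 \<le> (critical_speed f \<epsilon> - cbar) * v_plus f"
    using orbit_nonneg[OF assms critical_speed(1)[OF assms] v_plus_01(3)] b' by linarith
  thus "cbar \<le> critical_speed f \<epsilon>" using v_plus_01(1) by (simp add: zero_le_mult_iff)
qed

text \<open>Upper bound for the critical speed: a barrier that is of quadratic order at \<open>0\<close> and, beyond a
  small \<open>v\<^sub>1\<close>, differs from the limit energy \<open>c' s - F s\<close> of a slightly larger speed only by a constant
  and a small quadratic term. The cut-off \<open>\<theta>\<close> joins the two regimes.\<close>

lemma eventually_connecting:
  assumes \<delta>: "\<delta> > 0"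
  shows "eventually (\<lambda>\<epsilon>. cbar + \<delta> \<in> connecting \<epsilon>) (at_right 0)"
proof -
  define c c' where "c = cbar + \<delta>" and "c' = cbar + \<delta> / 2"
  \<comment> \<open>so small that \<open>k v\<^sub>1\<close> and \<open>2 a v\<^sub>1\<close>, with \<open>a\<close> as below, are at most \<open>\<delta> / 8\<close>\<close>
  define v1 where "v1 = min (\<delta> / (8 * k)) (1/2)"
  define a where "a = \<delta> / 8"
  define \<theta> where "\<theta> s = min 1 (s / v1)" for s
  have c: "c > 0" "c' > 0" "c' \<ge> \<delta> / 2" using \<delta> cbar_pos by (auto simp: c_def c'_def)
  have v1: "v1 > 0" "v1 \<le> 1/2" "k * v1 \<le> \<delta> / 8"
  proof -
    show "v1 > 0" "v1 \<le> 1/2" using \<delta> k_pos by (auto simp: v1_def)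
    have "k * v1 \<le> k * (\<delta> / (8 * k))" using k_pos by (intro mult_left_mono) (auto simp: v1_def)
    thus "k * v1 \<le> \<delta> / 8" using k_pos by simp
  qed
  have a: "a > 0" using \<delta> by (simp add: a_def)
  have \<theta>: "0 \<le> \<theta> s" "\<theta> s \<le> 1" if "0 \<le> s" for s using that v1 by (auto simp: \<theta>_def)
  define P where "P s = integral {0..s} (\<lambda>s. \<theta> s * (c' - f s))" for s
  have cont\<theta>: "continuous_on S \<theta>" for S
  proof -
    have "continuous_on S (\<lambda>s. s / v1)" using v1 by (intro continuous_intros) auto
    thus ?thesis unfolding \<theta>_def by (intro continuous_on_min continuous_on_const)
  qed
  have conti: "continuous_on {0..1} (\<lambda>s. \<theta> s * (c' - f s))"
    by (intro continuous_intros cont\<theta> cont_f)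
  have dP: "(P has_real_derivative \<theta> s * (c' - f s)) (at s within {0..1})" if "s \<in> {0..1}" for s
    unfolding P_def by (rule integral_has_real_derivative[OF conti that])
  have dP': "(P has_real_derivative \<theta> s * (c' - f s)) (at s)" if "s \<in> {0<..<1}" for s
    using dP[of s] within_01[of s] that by auto
  have contP: "continuous_on {0..1} P" by (rule DERIV_continuous_on) (rule dP)
  \<comment> \<open>\<open>Q\<close> is the effect of the cut-off; it is constant beyond \<open>v\<^sub>1\<close> and at least \<open>- c' v\<^sub>1\<close> there\<close>
  define Q where "Q s = P s - (c' * s - F s)" for s
  have Q_mvt: "\<exists>z. x < z \<and> z < y \<and> Q y - Q x = (y - x) * ((\<theta> z - 1) * (c' - f z))"
    if xy: "0 \<le> x" "x < y" "y \<le> 1" for x y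
  proof -
    have d: "(Q has_real_derivative (\<theta> z - 1) * (c' - f z)) (at z)" if "x < z" "z < y" for z
    proof -
      have z: "z \<in> {0<..<1}" using that xy by auto
      have "(Q has_real_derivative \<theta> z * (c' - f z) - (c' * 1 - f z)) (at z)"
        unfolding Q_def by (intro DERIV_diff DERIV_cmult DERIV_ident dP'[OF z] F_deriv_at[OF z])
      thus ?thesis by (rule DERIV_cong) (simp add: algebra_simps)
    qed
    have "continuous_on {0..1} Q" unfolding Q_def using contP F_cont by (intro continuous_intros)
    hence "continuous_on {x..y} Q" by (rule continuous_on_subset) (use xy in auto)
    then obtain l z where z: "x < z" "z < y" "(Q has_real_derivative l) (at z)" "Q y - Q x = (y - x) * l"
      using MVT[of x y Q] xy d real_differentiable_def by metis
    moreover have "l = (\<theta> z - 1) * (c' - f z)" using DERIV_unique[OF z(3) d] z by blast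
    ultimately show ?thesis by blast
  qed
  have Q0: "Q 0 = 0" by (simp add: Q_def P_def)
  have Qv1: "Q v1 \<ge> - (c' * v1)"
  proof -
    obtain z where z: "0 < z" "z < v1" "Q v1 - Q 0 = (v1 - 0) * ((\<theta> z - 1) * (c' - f z))"
      using Q_mvt[of 0 v1] v1 by auto
    have "f z \<ge> 0" using f_nonneg[of z] z v1 by auto
    have "(1 - \<theta> z) * (c' - f z) \<le> (1 - \<theta> z) * c'"
      using \<theta>[of z] z \<open>f z \<ge> 0\<close> by (intro mult_left_mono) auto
    also have "\<dots> \<le> 1 * c'" using \<theta>[of z] z c by (intro mult_right_mono) auto
    finally have "v1 * ((1 - \<theta> z) * (c' - f z)) \<le> v1 * c'" using v1 by simp
    thus ?thesis using z(3) Q0 by (simp add: algebra_simps)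
  qed
  \<comment> \<open>up to \<open>2 c' v\<^sub>1 / \<delta>\<close> the integrand is nonnegative; beyond it the extra speed \<open>\<delta> / 2\<close> outweighs \<open>Q\<close>\<close>
  have Pnonneg: "P s \<ge> 0" if s: "s \<in> {0..1}" for s
  proof (cases "s \<le> 2 * c' * v1 / \<delta>")
    case True
    show ?thesis unfolding P_def
    proof (rule integral_nonneg)
      show "(\<lambda>s. \<theta> s * (c' - f s)) integrable_on {0..s}"
        using continuous_on_subset[OF conti, of "{0..s}"] s by (intro integrable_continuous_real) auto
      fix x assume x: "x \<in> {0..s}"
      have "f x \<le> k * x" using f_le0[of x] x s by auto
      also have "\<dots> \<le> k * (2 * c' * v1 / \<delta>)" using x True k_pos by (intro mult_left_mono) auto
      also have "\<dots> = (k * v1) * (2 * c' / \<delta>)" by simp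
      also have "\<dots> \<le> \<delta> / 8 * (2 * c' / \<delta>)" using v1 c \<delta> by (intro mult_right_mono) auto
      also have "\<dots> \<le> c'" using \<delta> c by simp
      finally show "0 \<le> \<theta> x * (c' - f x)" using \<theta>[of x] x by simp
    qed
  next
    case False
    have "1 \<le> 2 * c' / \<delta>" using c \<delta> by simp
    hence "v1 * 1 \<le> v1 * (2 * c' / \<delta>)" using v1 by (intro mult_left_mono) auto
    hence sv1: "v1 < s" using False by (simp add: mult_ac)
    obtain z where z: "v1 < z" "Q s - Q v1 = (s - v1) * ((\<theta> z - 1) * (c' - f z))"
      using Q_mvt[of v1 s] sv1 v1 s by auto
    have "\<theta> z = 1" using z v1 by (simp add: \<theta>_def)
    hence "Q s \<ge> - (c' * v1)" using z Qv1 by simp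
    hence "P s \<ge> (cbar * s - F s) + \<delta> / 2 * s - c' * v1"
      by (simp add: Q_def c'_def algebra_simps)
    moreover have "\<delta> / 2 * s \<ge> c' * v1" using False \<delta> by (simp add: field_simps)
    ultimately show ?thesis using limit_energy_nonneg[OF s] by linarith
  qed
  have "((\<lambda>\<epsilon>. c * slope \<epsilon> (a * v1\<^sup>2)) \<longlongrightarrow> c * 1) (at_right 0)"
    using a v1 by (intro tendsto_mult tendsto_const slope_limit) simp
  moreover have "c' + \<delta> / 4 < c * 1" using \<delta> by (simp add: c_def c'_def)
  ultimately have "eventually (\<lambda>\<epsilon>. c' + \<delta> / 4 < c * slope \<epsilon> (a * v1\<^sup>2)) (at_right 0)"
    by (rule order_tendstoD(1))
  moreover have "eventually (\<lambda>\<epsilon>::real. \<epsilon> > 0) (at_right 0)" by (rule eventually_at_right_less)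
  ultimately show ?thesis
  proof eventually_elim
    fix \<epsilon> :: real assume r: "c' + \<delta> / 4 < c * slope \<epsilon> (a * v1\<^sup>2)" and eps: "0 < \<epsilon>"
    define \<beta> where "\<beta> s = a * s\<^sup>2 + P s" for s
    have "orbit \<epsilon> c 0 \<le> \<beta> 0"
    proof (rule orbit_le_barrier[OF eps c(1), where \<beta>' = "\<lambda>s. a * (2 * s) + \<theta> s * (c' - f s)"])
      show "continuous_on {0..1} \<beta>" unfolding \<beta>_def using contP by (intro continuous_intros)
      show "0 \<le> \<beta> 1" using Pnonneg[of 1] a by (simp add: \<beta>_def)
      fix s :: real assume s: "0 < s" "s < 1"
      show "(\<beta> has_real_derivative a * (2 * s) + \<theta> s * (c' - f s)) (at s)"
        unfolding \<beta>_def using s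
        by (intro DERIV_add DERIV_cmult dP') (auto intro!: derivative_eq_intros)
      have "a * s\<^sup>2 \<le> \<beta> s" using Pnonneg[of s] s by (simp add: \<beta>_def)
      hence mono: "c * slope \<epsilon> (a * s\<^sup>2) \<le> c * slope \<epsilon> (\<beta> s)"
        using c by (intro mult_left_mono slope_mono[OF eps]) auto
      have fs: "0 \<le> f s" "f s \<le> k * s" using f_nonneg[of s] f_le0[of s] s by auto
      have "a * (2 * s) + \<theta> s * (c' - f s) + f s \<le> c * slope \<epsilon> (a * s\<^sup>2)"
      proof (cases "v1 \<le> s")
        case True
        hence "\<theta> s = 1" using v1 by (simp add: \<theta>_def)
        moreover have "a * (2 * s) \<le> a * 2" using s a by simp
        ultimately have "a * (2 * s) + \<theta> s * (c' - f s) + f s \<le> c' + \<delta> / 4" by (simp add: a_def)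
        also have "\<dots> \<le> c * slope \<epsilon> (a * v1\<^sup>2)" using r by simp
        also have "\<dots> \<le> c * slope \<epsilon> (a * s\<^sup>2)"
          using c a v1 True by (intro mult_left_mono slope_mono[OF eps] power_mono) auto
        finally show ?thesis .
      next
        case False
        have \<theta>s: "\<theta> s = s / v1" using False v1 by (simp add: \<theta>_def)
        have "a * (2 * s) + \<theta> s * (c' - f s) + f s = a * (2 * s) + \<theta> s * c' + (1 - \<theta> s) * f s"
          by (simp add: algebra_simps)
        also have "(1 - \<theta> s) * f s \<le> 1 * f s"
          using \<theta>[of s] s fs by (intro mult_right_mono) auto
        also have "a * (2 * s) + \<theta> s * c' + 1 * f s \<le> a * (2 * s) + \<theta> s * c' + k * s" using fs by simp
        also have "\<dots> = s / v1 * (2 * a * v1 + c' + k * v1)"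
          using v1 by (simp add: \<theta>s field_simps)
        also have "\<dots> \<le> s / v1 * (c' + \<delta> / 4)"
        proof -
          have "2 * a * v1 \<le> 2 * a * (1/2)" using v1 a by (intro mult_left_mono) auto
          thus ?thesis using s v1 by (intro mult_left_mono) (auto simp: a_def)
        qed
        also have "\<dots> \<le> s / v1 * (c * slope \<epsilon> (a * v1\<^sup>2))"
          using s v1 r by (intro mult_left_mono) auto
        also have "\<dots> = c * (s / v1 * slope \<epsilon> (a * v1\<^sup>2))" by simp
        also have "\<dots> \<le> c * slope \<epsilon> (a * s\<^sup>2)"
          using False s c v1 a by (intro mult_left_mono slope_quadratic[OF eps]) auto
        finally show ?thesis by simp
      qed
      thus "a * (2 * s) + \<theta> s * (c' - f s) \<le> c * slope \<epsilon> (\<beta> s) - f s" using mono by linarith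
    qed auto
    hence "orbit \<epsilon> c 0 = 0" using orbit_nonneg[OF eps c(1), of 0] by (simp add: \<beta>_def P_def)
    thus "cbar + \<delta> \<in> connecting \<epsilon>" using c by (simp add: connecting_def c_def)
  qed
qed

lemma critical_speed_tendsto: "(critical_speed f \<longlongrightarrow> cbar) (at_right 0)"
proof (rule order_tendstoI)
  have pos: "eventually (\<lambda>\<epsilon>::real. \<epsilon> > 0) (at_right 0)" by (rule eventually_at_right_less)
  show "eventually (\<lambda>\<epsilon>. x < critical_speed f \<epsilon>) (at_right 0)" if "x < cbar" for x
    using pos by eventually_elim (use that critical_speed_ge(1) in \<open>auto intro: less_le_trans\<close>)
  show "eventually (\<lambda>\<epsilon>. critical_speed f \<epsilon> < x) (at_right 0)" if "cbar < x" for x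
  proof -
    have "eventually (\<lambda>\<epsilon>. cbar + (x - cbar) / 2 \<in> connecting \<epsilon>) (at_right 0)"
      using that by (intro eventually_connecting) simp
    with pos show ?thesis
    proof eventually_elim
      case (elim \<epsilon>)
      from critical_speed(3)[OF elim] show ?case using that by (simp add: field_simps)
    qed
  qed
qed

lemma limit_speed_eq: "limit_speed f = cbar"
  unfolding limit_speed_def using critical_speed_tendsto by (intro tendsto_Lim) auto

end

section \<open>Uniform convergence of monotone functions\<close>

text \<open>A variant of Polya's theorem: convergence is only needed at points where the limit takes each
  value of \<open>(0,1)\<close>.\<close>

lemma uniform_limit_monotone:
  fixes v :: "'a \<Rightarrow> real \<Rightarrow> real" and w :: "real \<Rightarrow> real"
  assumes v: "eventually (\<lambda>e. mono (v e) \<and> range (v e) \<subseteq> {0..1}) G"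
    and w: "mono w" "range w \<subseteq> {0..1}"
    and lim: "\<And>x. x \<in> {0<..<1} \<Longrightarrow> \<exists>z. w z = x \<and> ((\<lambda>e. v e z) \<longlongrightarrow> x) G"
  shows "uniform_limit UNIV v w G"
proof (rule uniform_limitI)
  fix \<eta> :: real assume \<eta>: "\<eta> > 0"
  obtain N :: nat where "3 / \<eta> < real N" using reals_Archimedean2 by blast
  moreover have "0 < 3 / \<eta>" using \<eta> by simp
  ultimately have N: "0 < real N" "3 / real N < \<eta>"
    using \<eta> by (linarith, subst pos_divide_less_eq, linarith, simp add: field_simps)
  have "\<exists>z. \<forall>i\<in>{1..<N}. w (z i) = real i / real N \<and> ((\<lambda>e. v e (z i)) \<longlongrightarrow> real i / real N) G"
    by (intro bchoice ballI lim) auto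
  then obtain z where z: "\<And>i. i \<in> {1..<N} \<Longrightarrow> w (z i) = real i / real N"
    "\<And>i. i \<in> {1..<N} \<Longrightarrow> ((\<lambda>e. v e (z i)) \<longlongrightarrow> real i / real N) G"
    by blast
  have "eventually (\<lambda>e. \<forall>i\<in>{1..<N}. dist (v e (z i)) (real i / real N) < 1 / real N) G"
    using N(1) by (intro eventually_ball_finite ballI tendstoD[OF z(2)]) auto
  with v show "eventually (\<lambda>e. \<forall>x\<in>UNIV. dist (v e x) (w x) < \<eta>) G"
  proof eventually_elim
    case (elim e)
    hence close: "\<bar>v e (z i) - real i / real N\<bar> < 1 / real N" if "i \<in> {1..<N}" for i
      using that by (auto simp: dist_real_def)
    have mv: "a \<le> b \<Longrightarrow> v e a \<le> v e b" for a b using elim(1) monoD by blast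
    have rv: "0 \<le> v e x" "v e x \<le> 1" for x using elim(1) rangeI[of "v e" x] by (force, force)
    have rw: "0 \<le> w x" "w x \<le> 1" for x using w(2) rangeI[of w x] by (force, force)
    show ?case
    proof
      fix x
      \<comment> \<open>\<open>w x\<close> lies in \<open>[i / N, (i + 1) / N)\<close>; compare with the grid points \<open>i + 1\<close> and \<open>i - 1\<close>, or with
        the bounds \<open>1\<close> and \<open>0\<close> if these are missing\<close>
      define i where "i = nat \<lfloor>real N * w x\<rfloor>"
      have "0 \<le> real N * w x" using N rw by simp
      hence i: "real i \<le> real N * w x" "real N * w x < real i + 1" by (auto simp: i_def)
      hence i': "real i / real N \<le> w x" "w x < (real i + 1) / real N"
        using N by (auto simp: field_simps)
      have frac: "(real i + 1) / real N = real i / real N + 1 / real N" by (simp add: add_divide_distrib)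
      have up: "v e x \<le> w x + 2 / real N"
      proof (cases "i + 1 < N")
        case True
        hence j: "i + 1 \<in> {1..<N}" by auto
        have "w x < w (z (i + 1))" using z(1)[OF j] i' by (simp add: add.commute)
        hence "x \<le> z (i + 1)" using monoD[OF w(1)] by (metis linorder_not_le less_imp_le)
        hence "v e x \<le> v e (z (i + 1))" by (rule mv)
        also have "\<dots> < (real i + 1) / real N + 1 / real N" using close[OF j] by (simp add: add.commute)
        finally show ?thesis using i' frac by simp
      next
        case False
        hence "real N \<le> real i + 1" by linarith
        hence "1 \<le> (real i + 1) / real N" using N by simp
        thus ?thesis using rv(2)[of x] i' frac N by simp
      qed
      have low: "w x \<le> v e x + 3 / real N"
      proof (cases "2 \<le> i")
        case True
        have "real N * w x \<le> real N" using rw N(1) by (intro mult_left_le) auto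
        hence "real i \<le> real N" using i(1) by linarith
        hence j: "i - 1 \<in> {1..<N}" using True by auto
        have r: "real (i - 1) / real N = real i / real N - 1 / real N"
          using True by (simp add: of_nat_diff diff_divide_distrib)
        have "0 < 1 / real N" using N by simp
        hence "w (z (i - 1)) < w x" using z(1)[OF j] i'(1) r by linarith
        hence "z (i - 1) \<le> x" using monoD[OF w(1)] by (metis linorder_not_le less_imp_le)
        hence "v e (z (i - 1)) \<le> v e x" by (rule mv)
        moreover have "real (i - 1) / real N - 1 / real N < v e (z (i - 1))" using close[OF j] by linarith
        ultimately show ?thesis using r i' frac by simp
      next
        case False
        hence "(real i + 1) / real N \<le> 2 / real N" using N by (intro divide_right_mono) auto
        also have "\<dots> \<le> 3 / real N" using N by (intro divide_right_mono) auto
        finally show ?thesis using rv(1)[of x] i' by linarith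
      qed
      have "2 / real N \<le> 3 / real N" using N by (intro divide_right_mono) auto
      thus "dist (v e x) (w x) < \<eta>" using up low N(2) by (auto simp: dist_real_def)
    qed
  qed
qed

section \<open>The limit of the critical profile\<close>

context unimodal_reaction
begin

text \<open>In this part \<open>cs \<epsilon>\<close> abbreviates the critical speed.\<close>

abbreviation cs :: "real \<Rightarrow> real" where "cs \<equiv> critical_speed f"

text \<open>The limit of the slope as a function of the profile value. It is continuous at \<open>v\<^sub>+\<close> because
  \<open>cbar\<close> is the value of \<open>f\<close> there. For \<open>s \<le> 0\<close> the value \<open>1\<close> is a matter of convenience.\<close>

definition limit_slope :: "real \<Rightarrow> real" where
  "limit_slope s = (if s \<le> v_plus f then 1 else f s / cbar)"

lemma limit_slope_right: "v_plus f \<le> s \<Longrightarrow> limit_slope s = f s / cbar"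
  using cbar_pos by (auto simp: limit_slope_def)

lemma limit_slope_cont: "continuous_on {0<..<1} limit_slope"
  unfolding limit_slope_def[abs_def]
proof (rule continuous_on_cases_le)
  show "continuous_on {s \<in> {0<..<1}. v_plus f \<le> s} (\<lambda>s. f s / cbar)"
    by (rule continuous_on_divide[OF continuous_on_subset[OF cont_f] continuous_on_const])
      (use cbar_pos in auto)
  show "1 = f s / cbar" if "s = v_plus f" for s using that cbar_pos by simp
qed auto

lemma limit_slope_pos: "s \<in> {0<..<1} \<Longrightarrow> limit_slope s > 0"
  using f_pos cbar_pos by (auto simp: limit_slope_def)

sublocale lim: positive_speed limit_slope
  by unfold_locales (use limit_slope_cont limit_slope_pos in auto)

lemma ev_pos: "eventually (\<lambda>\<epsilon>::real. \<epsilon> > 0) (at_right 0)"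
  by (rule eventually_at_right_less)

lemma orbit_ge_limit_energy:
  assumes eps: "\<epsilon> > 0" and s: "0 \<le> s" "s \<le> v_plus f"
  shows "orbit \<epsilon> (cs \<epsilon>) s \<ge> (cbar * s - F s) - (cs \<epsilon> - cbar) * v_plus f"
proof -
  have "cs \<epsilon> * s - F s - orbit \<epsilon> (cs \<epsilon>) s \<le> cs \<epsilon> * v_plus f - F (v_plus f) - orbit \<epsilon> (cs \<epsilon>) (v_plus f)"
    using s v_plus_01 by (intro orbit_deficit_mono[OF eps critical_speed(1)[OF eps]]) auto
  also have "\<dots> \<le> (cs \<epsilon> - cbar) * v_plus f"
    using orbit_nonneg[OF eps critical_speed(1)[OF eps] v_plus_01(3)] v_plus(3)
    by (simp add: algebra_simps)
  finally have "orbit \<epsilon> (cs \<epsilon>) s \<ge> (cs \<epsilon> * s - F s) - (cs \<epsilon> - cbar) * v_plus f" by simp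
  moreover have "cbar * s \<le> cs \<epsilon> * s" using critical_speed_ge(1)[OF eps] s by (intro mult_right_mono) auto
  ultimately show ?thesis by simp
qed

text \<open>Where \<open>f\<close> decreases, the profile slope does not exceed the equilibrium slope \<open>f s / cs \<epsilon>\<close>:
  otherwise the energy with the latter slope, which is smaller, would be a constant upper barrier on
  \<open>[s, 1]\<close>.\<close>

lemma slope_le_equilibrium:
  assumes eps: "\<epsilon> > 0" and s: "m \<le> s" "s \<le> 1"
  shows "cs \<epsilon> * speed_profile \<epsilon> s \<le> f s"
proof (rule ccontr)
  assume not: "\<not> cs \<epsilon> * speed_profile \<epsilon> s \<le> f s"
  note c = critical_speed(1)[OF eps]
  have s01: "s \<in> {0..1}" using s m by auto
  define y where "y = orbit \<epsilon> (cs \<epsilon>) s"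
  have "\<exists>B\<ge>0. B \<le> y \<and> cs \<epsilon> * slope \<epsilon> B = f s"
  proof (rule IVT')
    show "cs \<epsilon> * slope \<epsilon> 0 \<le> f s" using eps f_nonneg[OF s01] by simp
    show "f s \<le> cs \<epsilon> * slope \<epsilon> y" using not by (simp add: y_def speed_profile_def)
    show "0 \<le> y" unfolding y_def by (rule orbit_nonneg[OF eps c s01])
    show "continuous_on {0..y} (\<lambda>B. cs \<epsilon> * slope \<epsilon> B)"
      using continuous_on_subset[OF slope_continuous[OF eps], of "{0..y}"] by (intro continuous_intros) auto
  qed
  then obtain B where B: "0 \<le> B" "B \<le> y" "cs \<epsilon> * slope \<epsilon> B = f s" by blast
  have "y \<le> B" unfolding y_def
  proof (rule orbit_le_barrier[OF eps c s01, where \<beta>' = "\<lambda>_. 0"])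
    show "0 \<le> cs \<epsilon> * slope \<epsilon> B - f x" if "s < x" "x < 1" for x
      using B f_dec[of s x] s that by simp
  qed (use B in auto)
  hence "cs \<epsilon> * slope \<epsilon> y = f s" using B by simp
  thus False using not by (simp add: y_def speed_profile_def)
qed

lemma orbit_decreasing:
  assumes eps: "\<epsilon> > 0" and st: "m \<le> s" "s \<le> t" "t \<le> 1"
  shows "orbit \<epsilon> (cs \<epsilon>) t \<le> orbit \<epsilon> (cs \<epsilon>) s" "speed_profile \<epsilon> t \<le> speed_profile \<epsilon> s"
proof -
  note c = critical_speed(1)[OF eps]
  show le: "orbit \<epsilon> (cs \<epsilon>) t \<le> orbit \<epsilon> (cs \<epsilon>) s"
  proof (rule DERIV_nonpos_imp_decreasing_open[OF st(2)])
    fix x assume x: "s < x" "x < t"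
    have "(orbit \<epsilon> (cs \<epsilon>) has_real_derivative cs \<epsilon> * slope \<epsilon> (orbit \<epsilon> (cs \<epsilon>) x) - f x) (at x)"
      using x st m by (intro orbit_deriv_at[OF eps c]) auto
    moreover have "cs \<epsilon> * slope \<epsilon> (orbit \<epsilon> (cs \<epsilon>) x) - f x \<le> 0"
      using slope_le_equilibrium[OF eps, of x] x st by (simp add: speed_profile_def)
    ultimately show "\<exists>y. (orbit \<epsilon> (cs \<epsilon>) has_real_derivative y) (at x) \<and> y \<le> 0" by blast
  next
    show "continuous_on {s..t} (orbit \<epsilon> (cs \<epsilon>))"
      by (rule continuous_on_subset[OF orbit_cont[OF eps c]]) (use st m in auto)
  qed
  thus "speed_profile \<epsilon> t \<le> speed_profile \<epsilon> s"
    unfolding speed_profile_def by (rule slope_mono[OF eps])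
qed

text \<open>A lower bound for the slope from the mean value theorem on \<open>[s, t]\<close>: the energy available at \<open>s\<close>
  is at most \<open>(cs \<epsilon> - cbar) v\<^sub>+\<close>, and both \<open>f\<close> and the slope decrease.\<close>

lemma slope_ge_average:
  assumes eps: "\<epsilon> > 0" and st: "v_plus f \<le> s" "s < t" "t \<le> 1"
  shows "cs \<epsilon> * speed_profile \<epsilon> s \<ge> f t - (cs \<epsilon> - cbar) * v_plus f / (t - s)"
proof -
  note c = critical_speed(1)[OF eps]
  define y where "y = orbit \<epsilon> (cs \<epsilon>)"
  have d: "(y has_real_derivative cs \<epsilon> * slope \<epsilon> (y x) - f x) (at x)" if "s < x" "x < t" for x
    unfolding y_def by (rule orbit_deriv_at[OF eps c]) (use that st v_plus_01 in auto)
  have cont: "continuous_on {s..t} y" unfolding y_def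
    by (rule continuous_on_subset[OF orbit_cont[OF eps c]]) (use st v_plus_01 in auto)
  obtain l z where z: "s < z" "z < t" "(y has_real_derivative l) (at z)" "y t - y s = (t - s) * l"
    using MVT[OF st(2) cont] d real_differentiable_def by metis
  have l: "l = cs \<epsilon> * slope \<epsilon> (y z) - f z" using DERIV_unique[OF z(3) d] z by blast
  have "y t \<ge> 0" unfolding y_def by (rule orbit_nonneg[OF eps c]) (use st v_plus_01 in auto)
  moreover have "y s \<le> y (v_plus f)" unfolding y_def
    using st v_plus by (intro orbit_decreasing(1)[OF eps]) auto
  ultimately have "- ((cs \<epsilon> - cbar) * v_plus f) \<le> (t - s) * l"
    using critical_speed_ge(2)[OF eps] z(4) by (simp add: y_def)
  hence "- ((cs \<epsilon> - cbar) * v_plus f / (t - s)) \<le> l" using st by (simp add: field_simps)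
  moreover have "f t \<le> f z" using f_dec[of z t] z st v_plus by simp
  moreover have "cs \<epsilon> * slope \<epsilon> (y z) \<le> cs \<epsilon> * speed_profile \<epsilon> s"
    using orbit_decreasing(2)[OF eps, of s z] z st v_plus c
    by (intro mult_left_mono) (auto simp: y_def speed_profile_def)
  ultimately show ?thesis unfolding l by linarith
qed

lemma gap_tendsto: "((\<lambda>\<epsilon>. (cs \<epsilon> - cbar) * v_plus f) \<longlongrightarrow> 0) (at_right 0)"
proof -
  have "((\<lambda>\<epsilon>. (cs \<epsilon> - cbar) * v_plus f) \<longlongrightarrow> (cbar - cbar) * v_plus f) (at_right 0)"
    by (intro tendsto_intros critical_speed_tendsto)
  thus ?thesis by simp
qed

lemma speed_profile_bounds: "\<epsilon> > 0 \<Longrightarrow> 0 \<le> speed_profile \<epsilon> s" "\<epsilon> > 0 \<Longrightarrow> speed_profile \<epsilon> s < 1"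
  unfolding speed_profile_def by (rule slope_nonneg slope_less_1; assumption)+

text \<open>Where the limit energy is at least \<open>\<mu>\<close>, the critical energy is eventually at least \<open>\<mu> / 2\<close>.\<close>

lemma eventually_profile_ge_slope:
  assumes \<mu>: "\<mu> > 0" and S: "S \<subseteq> {0..v_plus f}" "\<And>s. s \<in> S \<Longrightarrow> cbar * s - F s \<ge> \<mu>"
  shows "eventually (\<lambda>\<epsilon>. \<forall>s\<in>S. slope \<epsilon> (\<mu> / 2) \<le> speed_profile \<epsilon> s) (at_right 0)"
proof -
  have "eventually (\<lambda>\<epsilon>. (cs \<epsilon> - cbar) * v_plus f < \<mu> / 2) (at_right 0)"
    using order_tendstoD(2)[OF gap_tendsto, of "\<mu> / 2"] \<mu> by simp
  with ev_pos show ?thesis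
  proof eventually_elim
    case (elim \<epsilon>)
    show ?case
    proof
      fix s assume s: "s \<in> S"
      have "\<mu> / 2 \<le> orbit \<epsilon> (cs \<epsilon>) s"
        using orbit_ge_limit_energy[OF elim(1), of s] S(2)[OF s] S(1) s elim(2) by fastforce
      thus "slope \<epsilon> (\<mu> / 2) \<le> speed_profile \<epsilon> s"
        unfolding speed_profile_def by (rule slope_mono[OF elim(1)])
    qed
  qed
qed

lemma speed_profile_tendsto:
  assumes s: "s \<in> {0<..<1}"
  shows "((\<lambda>\<epsilon>. speed_profile \<epsilon> s) \<longlongrightarrow> limit_slope s) (at_right 0)"
proof (cases "s < v_plus f")
  case True
  define \<mu> where "\<mu> = cbar * s - F s"
  have \<mu>: "\<mu> > 0" unfolding \<mu>_def using s True by (intro limit_energy_pos) auto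
  have "eventually (\<lambda>\<epsilon>. \<forall>s\<in>{s}. slope \<epsilon> (\<mu> / 2) \<le> speed_profile \<epsilon> s) (at_right 0)"
    using s True by (intro eventually_profile_ge_slope[OF \<mu>]) (auto simp: \<mu>_def)
  hence lo: "eventually (\<lambda>\<epsilon>. slope \<epsilon> (\<mu> / 2) \<le> speed_profile \<epsilon> s) (at_right 0)" by simp
  have up: "eventually (\<lambda>\<epsilon>. speed_profile \<epsilon> s \<le> 1) (at_right 0)"
    using ev_pos by eventually_elim (simp add: speed_profile_bounds less_imp_le)
  have "((\<lambda>\<epsilon>. speed_profile \<epsilon> s) \<longlongrightarrow> 1) (at_right 0)"
    using \<mu> by (intro tendsto_sandwich[OF lo up] slope_limit tendsto_const) auto
  thus ?thesis using True by (simp add: limit_slope_def)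
next
  case False
  hence vs: "v_plus f \<le> s" by simp
  have up: "((\<lambda>\<epsilon>. f s / cs \<epsilon>) \<longlongrightarrow> f s / cbar) (at_right 0)"
    using cbar_pos by (intro tendsto_intros critical_speed_tendsto) auto
  have "((\<lambda>\<epsilon>. speed_profile \<epsilon> s) \<longlongrightarrow> f s / cbar) (at_right 0)"
  proof (rule order_tendstoI)
    fix x assume "f s / cbar < x"
    from order_tendstoD(2)[OF up this] ev_pos
    show "eventually (\<lambda>\<epsilon>. speed_profile \<epsilon> s < x) (at_right 0)"
    proof eventually_elim
      case (elim \<epsilon>)
      have "speed_profile \<epsilon> s \<le> f s / cs \<epsilon>"
        using slope_le_equilibrium[OF elim(2), of s] critical_speed(1)[OF elim(2)] vs s v_plus
        by (simp add: field_simps)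
      with elim(1) show ?case by simp
    qed
  next
    fix x assume x: "x < f s / cbar"
    have "isCont f s"
      using continuous_on_interior[OF cont_f] s by auto
    hence "(f \<longlongrightarrow> f s) (at_right s)" by (simp add: isCont_def filterlim_at_split)
    hence "((\<lambda>t. f t / cbar) \<longlongrightarrow> f s / cbar) (at_right s)"
      using cbar_pos by (intro tendsto_divide tendsto_const) auto
    from order_tendstoD(1)[OF this x]
    obtain b where b: "s < b" "\<And>t. s < t \<Longrightarrow> t < b \<Longrightarrow> x < f t / cbar"
      unfolding eventually_at_right_field by blast
    define t where "t = min ((s + b) / 2) ((s + 1) / 2)"
    have t: "s < t" "t < b" "t \<le> 1" using s b(1) by (auto simp: t_def min_def field_simps)
    have "((\<lambda>\<epsilon>. (f t - (cs \<epsilon> - cbar) * v_plus f / (t - s)) / cs \<epsilon>) \<longlongrightarrow> (f t - 0 / (t - s)) / cbar) (at_right 0)"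
      using cbar_pos t by (intro tendsto_intros gap_tendsto critical_speed_tendsto) auto
    hence "eventually (\<lambda>\<epsilon>. x < (f t - (cs \<epsilon> - cbar) * v_plus f / (t - s)) / cs \<epsilon>) (at_right 0)"
      by (rule order_tendstoD(1)) (use b(2)[of t] t in simp)
    with ev_pos show "eventually (\<lambda>\<epsilon>. x < speed_profile \<epsilon> s) (at_right 0)"
    proof eventually_elim
      case (elim \<epsilon>)
      have "(f t - (cs \<epsilon> - cbar) * v_plus f / (t - s)) / cs \<epsilon> \<le> speed_profile \<epsilon> s"
        using slope_ge_average[OF elim(1) vs t(1,3)] critical_speed(1)[OF elim(1)]
        by (simp add: pos_divide_le_eq mult.commute)
      with elim(2) show ?case by simp
    qed
  qed
  thus ?thesis using limit_slope_right[OF vs] by simp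
qed

text \<open>To the left of \<open>m\<close> the bound comes from the limit energy, to the right from monotonicity and the
  convergence at a single point.\<close>

lemma eventually_profile_bounded_below:
  assumes ab: "0 < a" "b < 1"
  shows "\<exists>\<eta>>0. eventually (\<lambda>\<epsilon>. \<forall>s\<in>{a..b}. \<eta> \<le> speed_profile \<epsilon> s) (at_right 0)"
proof -
  define a' b' where "a' = min a m" and "b' = max b m"
  have ab': "0 < a'" "a' \<le> m" "m \<le> b'" "b' < 1" "a' \<le> a" "b \<le> b'"
    using ab m by (auto simp: a'_def b'_def)
  have b'01: "b' \<in> {0<..<1}" using ab' m by auto
  obtain x where x: "x \<in> {a'..m}" "\<And>s. s \<in> {a'..m} \<Longrightarrow> cbar * x - F x \<le> cbar * s - F s"
  proof -
    have "continuous_on {a'..m} (\<lambda>s. cbar * s - F s)"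
      using continuous_on_subset[OF F_cont, of "{a'..m}"] ab' m by (intro continuous_intros) auto
    thus ?thesis using continuous_attains_inf[of "{a'..m}" "\<lambda>s. cbar * s - F s"] ab' that by auto
  qed
  define \<mu> where "\<mu> = cbar * x - F x"
  have \<mu>: "\<mu> > 0" unfolding \<mu>_def using x(1) ab' v_plus by (intro limit_energy_pos) auto
  have e1: "eventually (\<lambda>\<epsilon>. \<forall>s\<in>{a'..m}. slope \<epsilon> (\<mu> / 2) \<le> speed_profile \<epsilon> s) (at_right 0)"
    using x ab' v_plus by (intro eventually_profile_ge_slope[OF \<mu>]) (auto simp: \<mu>_def)
  have "eventually (\<lambda>\<epsilon>. 1 / 2 < slope \<epsilon> (\<mu> / 2)) (at_right 0)"
    using \<mu> by (intro order_tendstoD(1)[OF slope_limit]) auto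
  moreover have "eventually (\<lambda>\<epsilon>. limit_slope b' / 2 < speed_profile \<epsilon> b') (at_right 0)"
    using limit_slope_pos[OF b'01] by (intro order_tendstoD(1)[OF speed_profile_tendsto[OF b'01]]) simp
  ultimately have "eventually (\<lambda>\<epsilon>. \<forall>s\<in>{a..b}. min (1 / 2) (limit_slope b' / 2) \<le> speed_profile \<epsilon> s) (at_right 0)"
    using e1 ev_pos
  proof eventually_elim
    case (elim \<epsilon>)
    show ?case
    proof
      fix s assume s: "s \<in> {a..b}"
      show "min (1 / 2) (limit_slope b' / 2) \<le> speed_profile \<epsilon> s"
      proof (cases "s \<le> m")
        case True
        hence "s \<in> {a'..m}" using s ab' by auto
        thus ?thesis using elim by fastforce
      next
        case False
        hence "speed_profile \<epsilon> b' \<le> speed_profile \<epsilon> s"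
          using s ab' by (intro orbit_decreasing(2)[OF elim(4)]) auto
        thus ?thesis using elim(2) by simp
      qed
    qed
  qed
  moreover have "min (1 / 2) (limit_slope b' / 2) > 0" using limit_slope_pos[OF b'01] by simp
  ultimately show ?thesis by blast
qed

lemma integral_slowness_tendsto:
  assumes ab: "0 < a" "b < 1"
  shows "((\<lambda>\<epsilon>. integral {a..b} (\<lambda>s. 1 / speed_profile \<epsilon> s)) \<longlongrightarrow> integral {a..b} (\<lambda>s. 1 / limit_slope s)) (at_right 0)"
  unfolding tendsto_at_iff_sequentially
proof (intro allI impI)
  fix X :: "nat \<Rightarrow> real"
  assume X: "\<forall>i. X i \<in> {0<..} - {0}" "X \<longlonglongrightarrow> 0"
  have Xpos: "X i > 0" for i using X(1) by auto
  have XF: "filterlim X (at_right 0) sequentially"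
    unfolding filterlim_at using X(2) Xpos by (auto simp: less_imp_neq[symmetric] intro!: always_eventually)
  obtain \<eta> where \<eta>: "\<eta> > 0" "eventually (\<lambda>\<epsilon>. \<forall>s\<in>{a..b}. \<eta> \<le> speed_profile \<epsilon> s) (at_right 0)"
    using eventually_profile_bounded_below[OF ab] by blast
  have "eventually (\<lambda>i. \<forall>s\<in>{a..b}. \<eta> \<le> speed_profile (X i) s) sequentially"
    using eventually_compose_filterlim[OF \<eta>(2) XF] .
  then obtain N where N: "\<And>i s. i \<ge> N \<Longrightarrow> s \<in> {a..b} \<Longrightarrow> \<eta> \<le> speed_profile (X i) s"
    unfolding eventually_sequentially by blast
  have "(\<lambda>i. integral {a..b} (\<lambda>s. 1 / speed_profile (X (i + N)) s)) \<longlonglongrightarrow> integral {a..b} (\<lambda>s. 1 / limit_slope s)"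
  proof (rule dominated_convergence(2)[where h = "\<lambda>_. 1 / \<eta>"])
    show "(\<lambda>s. 1 / speed_profile (X (i + N)) s) integrable_on {a..b}" for i
    proof (rule integrable_continuous_real)
      interpret front_speed "speed_profile (X (i + N))" "cs (X (i + N)) / X (i + N) + sqrt (k / X (i + N))"
        by (rule front_speed_profile[OF Xpos])
      have ne: "\<forall>s\<in>{a..b}. speed_profile (X (i + N)) s \<noteq> 0"
      proof
        fix s assume "s \<in> {a..b}"
        hence "s \<in> {0<..<1}" using ab by auto
        from h_pos[OF this] show "speed_profile (X (i + N)) s \<noteq> 0" by simp
      qed
      show "continuous_on {a..b} (\<lambda>s. 1 / speed_profile (X (i + N)) s)"
        by (rule continuous_on_divide[OF continuous_on_const continuous_on_subset[OF cont_h] ne])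
          (use ab in auto)
    qed
    show "norm (1 / speed_profile (X (i + N)) s) \<le> 1 / \<eta>" if "s \<in> {a..b}" for i s
      using N[of "i + N" s] that \<eta>(1) by (auto simp: field_simps)
    show "(\<lambda>i. 1 / speed_profile (X (i + N)) s) \<longlonglongrightarrow> 1 / limit_slope s" if "s \<in> {a..b}" for s
    proof -
      have s: "s \<in> {0<..<1}" using that ab by auto
      have "(\<lambda>i. speed_profile (X i) s) \<longlonglongrightarrow> limit_slope s"
        by (rule filterlim_compose[OF speed_profile_tendsto[OF s] XF])
      hence "(\<lambda>i. speed_profile (X (i + N)) s) \<longlonglongrightarrow> limit_slope s" by (rule LIMSEQ_ignore_initial_segment)
      thus ?thesis using limit_slope_pos[OF s] by (intro tendsto_divide tendsto_const) auto
    qed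
  qed (simp add: integrable_continuous_real)
  hence "(\<lambda>i. integral {a..b} (\<lambda>s. 1 / speed_profile (X i) s)) \<longlonglongrightarrow> integral {a..b} (\<lambda>s. 1 / limit_slope s)"
    by (rule LIMSEQ_offset)
  thus "((\<lambda>\<epsilon>. integral {a..b} (\<lambda>s. 1 / speed_profile \<epsilon> s)) \<circ> X) \<longlonglongrightarrow> integral {a..b} (\<lambda>s. 1 / limit_slope s)"
    by (simp add: o_def)
qed

lemma travel_tendsto:
  assumes "a \<in> {0<..<1}" "b \<in> {0<..<1}"
  shows "((\<lambda>\<epsilon>. travel (speed_profile \<epsilon>) a b) \<longlongrightarrow> travel limit_slope a b) (at_right 0)"
  using integral_slowness_tendsto[of a b] integral_slowness_tendsto[of b a] assms
  by (cases "a \<le> b") (auto simp: travel_def intro!: tendsto_minus)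

text \<open>The profile takes the value \<open>x\<close> at a time that converges, and it is \<open>1\<close>-Lipschitz.\<close>

lemma critical_profile_at_limit_time:
  assumes v0: "v0 \<in> {0<..<1}" and x: "x \<in> {0<..<1}"
  shows "((\<lambda>\<epsilon>. critical_profile f v0 \<epsilon> (travel limit_slope v0 x)) \<longlongrightarrow> x) (at_right 0)"
proof -
  define T where "T = travel limit_slope v0 x"
  define t where "t \<epsilon> = travel (speed_profile \<epsilon>) v0 x" for \<epsilon>
  have "((\<lambda>\<epsilon>. T - t \<epsilon>) \<longlongrightarrow> T - T) (at_right 0)"
    unfolding t_def T_def by (intro tendsto_intros travel_tendsto v0 x)
  hence lim0: "((\<lambda>\<epsilon>. T - t \<epsilon>) \<longlongrightarrow> 0) (at_right 0)" by simp
  have "((\<lambda>\<epsilon>. critical_profile f v0 \<epsilon> T - x) \<longlongrightarrow> 0) (at_right 0)"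
  proof (rule Lim_null_comparison[OF _ tendsto_rabs_zero[OF lim0]])
    show "eventually (\<lambda>\<epsilon>. norm (critical_profile f v0 \<epsilon> T - x) \<le> \<bar>T - t \<epsilon>\<bar>) (at_right 0)"
      using ev_pos
    proof eventually_elim
      case (elim \<epsilon>)
      interpret front_speed "speed_profile \<epsilon>" "cs \<epsilon> / \<epsilon> + sqrt (k / \<epsilon>)"
        by (rule front_speed_profile[OF elim])
      have lip: "\<bar>flow 0 v0 z - flow 0 v0 z'\<bar> \<le> 1 * \<bar>z - z'\<bar>" for z z'
      proof -
        have "norm (flow 0 v0 z - flow 0 v0 z') \<le> 1 * norm (z - z')"
        proof (rule field_differentiable_bound[of UNIV])
          show "norm (speed_profile \<epsilon> (flow 0 v0 z)) \<le> 1" for z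
            using speed_profile_bounds[OF elim, of "flow 0 v0 z"] by simp
        qed (use flow_deriv in auto)
        thus ?thesis by simp
      qed
      have "flow 0 v0 (t \<epsilon>) = x" using flow_travel[OF v0 x, of 0] by (simp add: t_def)
      thus ?case using lip[of T "t \<epsilon>"] by (simp add: critical_profile_eq[OF elim v0])
    qed
  qed
  hence "((\<lambda>\<epsilon>. (critical_profile f v0 \<epsilon> T - x) + x) \<longlongrightarrow> 0 + x) (at_right 0)"
    by (intro tendsto_add tendsto_const)
  thus ?thesis by (simp add: T_def)
qed

section \<open>The limit profile\<close>

sublocale inner: front_speed "\<lambda>s. f s / cbar" "k / cbar"
proof
  show "continuous_on {0<..<1} (\<lambda>s. f s / cbar)"
    by (rule continuous_on_divide[OF continuous_on_subset[OF cont_f] continuous_on_const])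
      (use cbar_pos in auto)
  show "0 < f s / cbar" if "s \<in> {0<..<1}" for s using f_pos[OF that] cbar_pos by simp
  show "0 < k / cbar" using k_pos cbar_pos by simp
  show "f s / cbar \<le> k / cbar * s" if "s \<in> {0..1}" for s
    using f_le0[OF that] cbar_pos by (simp add: divide_right_mono)
  show "f s / cbar \<le> k / cbar * (1 - s)" if "s \<in> {0..1}" for s
    using f_le1[OF that] cbar_pos by (simp add: divide_right_mono)
qed

text \<open>The defining conditions of \<open>V_I\<close> allow the value \<open>1\<close>; the linear bound on \<open>f\<close> at \<open>1\<close> excludes it.\<close>

lemma V_I_eq:
  assumes v0: "v0 \<in> {0<..<1}"
  shows "V_I f z0 v0 = inner.flow z0 v0"
  unfolding V_I_def limit_speed_eq
proof (rule the_equality)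
  let ?w = "inner.flow z0 v0"
  have d: "(?w has_real_derivative f (?w z) / cbar) (at z)" for z by (rule inner.flow_deriv)
  have "0 < ?w z \<and> ?w z \<le> 1" for z using inner.flow(1)[of z0 v0 z] by auto
  moreover have "?w differentiable at z" for z using d real_differentiable_def by blast
  moreover have "cbar * deriv ?w z = f (?w z)" for z using DERIV_imp_deriv[OF d] cbar_pos by simp
  ultimately show "(\<forall>z. 0 < ?w z \<and> ?w z \<le> 1) \<and>
      (\<forall>z. ?w differentiable at z \<and> cbar * deriv ?w z = f (?w z)) \<and> ?w z0 = v0"
    using inner.flow_init[OF v0] by blast
  fix w assume w: "(\<forall>z. 0 < w z \<and> w z \<le> 1) \<and>
      (\<forall>z. w differentiable at z \<and> cbar * deriv w z = f (w z)) \<and> w z0 = v0"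
  show "w = ?w"
  proof (rule inner.flow_unique)
    show "w z \<in> {0..1}" for z using w by (simp add: less_imp_le)
    show "(w has_real_derivative f (w z) / cbar) (at z)" for z
    proof -
      have "(w has_real_derivative deriv w z) (at z)"
        using w DERIV_deriv_iff_real_differentiable by blast
      moreover have "deriv w z = f (w z) / cbar"
        using w cbar_pos by (metis nonzero_mult_div_cancel_left less_irrefl)
      ultimately show ?thesis by simp
    qed
    show "0 \<le> f s / cbar" if "s \<in> {0..1}" for s using f_nonneg[OF that] cbar_pos by simp
  qed (use w v0 in auto)
qed

lemma travel_limit_left:
  assumes "x \<in> {0<..v_plus f}"
  shows "travel limit_slope (v_plus f) x = x - v_plus f"
proof -
  have "travel limit_slope (v_plus f) x = travel (\<lambda>_. 1) (v_plus f) x"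
    using assms by (intro travel_cong) (auto simp: limit_slope_def)
  also have "\<dots> = x - v_plus f" using assms by (auto simp: travel_def)
  finally show ?thesis .
qed

lemma travel_limit_right:
  assumes "v_plus f \<le> a" "v_plus f \<le> b"
  shows "travel limit_slope a b = travel (\<lambda>s. f s / cbar) a b"
  using assms by (intro travel_cong limit_slope_right) auto

lemma V0_01: "V0 \<in> {0<..<1}" by (simp add: V0_def)

lemma z_plus:
  assumes "v_plus f < V0"
  shows "\<exists>!z. V_I f 0 V0 z = v_plus f" "z_plus f < 0"
    "z_plus f = travel limit_slope V0 (v_plus f)"
proof -
  define T where "T = travel (\<lambda>s. f s / cbar) V0 (v_plus f)"
  have T: "V_I f 0 V0 T = v_plus f"
    using inner.flow_travel[OF V0_01 v_plus_01(2), of 0] by (simp add: V_I_eq[OF V0_01] T_def)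
  have uniq: "z = T" if "V_I f 0 V0 z = v_plus f" for z
    using that T inner.flow_less[of z T 0 V0] inner.flow_less[of T z 0 V0]
    by (cases z T rule: linorder_cases) (auto simp: V_I_eq[OF V0_01])
  show "\<exists>!z. V_I f 0 V0 z = v_plus f" using T uniq by blast
  have zT: "z_plus f = T" unfolding z_plus_def using T uniq by (intro the_equality)
  show "z_plus f = travel limit_slope V0 (v_plus f)"
    unfolding zT T_def using assms by (intro travel_limit_right[symmetric]) auto
  show "z_plus f < 0"
  proof (rule ccontr)
    assume "\<not> z_plus f < 0"
    hence "inner.flow 0 V0 0 \<le> inner.flow 0 V0 T" unfolding zT by (intro inner.flow_mono) simp
    thus False using T assms inner.flow_init[OF V0_01, of 0] by (simp add: V_I_eq[OF V0_01])
  qed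
qed

lemma V_L_mono: "z \<le> z' \<Longrightarrow> V_L a b z \<le> V_L a b z'"
  by (auto simp: V_L_def)

lemma V_L_range: "0 \<le> V_L a b z" "V_L a b z \<le> 1"
  by (auto simp: V_L_def)

text \<open>Both cases in the definition of \<open>v_bar\<close> join a broken line on the left to an inner solution on
  the right at a point where the latter equals \<open>v\<^sub>+\<close>.\<close>

lemma v_bar_glue:
  assumes z: "v_bar f = (\<lambda>z. if z \<le> a then V_L b c z else inner.flow d e z)"
    and L: "V_L b c a \<le> v_plus f" and I: "inner.flow d e a = v_plus f"
  shows "mono (v_bar f)" "range (v_bar f) \<subseteq> {0..1}"
proof -
  have fl: "0 \<le> inner.flow d e z" "inner.flow d e z \<le> 1" for z
    using inner.flow(1)[of d e z] by auto
  show "range (v_bar f) \<subseteq> {0..1}" unfolding z using fl V_L_range by auto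
  show "mono (v_bar f)"
  proof (rule monoI)
    fix x y :: real assume xy: "x \<le> y"
    show "v_bar f x \<le> v_bar f y"
    proof (cases "x \<le> a \<and> a < y")
      case True
      have "V_L b c x \<le> v_plus f" using V_L_mono[of x a b c] True L by simp
      also have "\<dots> \<le> inner.flow d e y" using inner.flow_mono[of a y d e] True I by simp
      finally show ?thesis using True by (simp add: z)
    next
      case False
      thus ?thesis using xy V_L_mono[of x y b c] inner.flow_mono[of x y d e] by (auto simp: z)
    qed
  qed
qed

lemma v_bar:
  shows "mono (v_bar f)" "range (v_bar f) \<subseteq> {0..1}"
    and "\<And>x. x \<in> {0<..<1} \<Longrightarrow> v_bar f (travel limit_slope V0 x) = x"
proof -
  have add: "travel limit_slope V0 x = travel limit_slope V0 (v_plus f) + travel limit_slope (v_plus f) x"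
    if "x \<in> {0<..<1}" for x
    using lim.travel_add[OF V0_01 v_plus_01(2) that] by simp
  have "mono (v_bar f) \<and> range (v_bar f) \<subseteq> {0..1} \<and>
    (\<forall>x\<in>{0<..<1}. v_bar f (travel limit_slope V0 x) = x)"
  proof (cases "v_plus f \<ge> V0")
    case True
    have eq: "v_bar f = (\<lambda>z. if z \<le> v_plus f - V0 then V_L 0 V0 z
        else inner.flow (v_plus f - V0) (v_plus f) z)"
      using True unfolding v_bar_def[abs_def] V_I_eq[OF v_plus_01(2)] by simp
    have L: "V_L 0 V0 (v_plus f - V0) \<le> v_plus f" using v_plus_01 True by (simp add: V_L_def V0_def)
    have t: "travel limit_slope V0 (v_plus f) = v_plus f - V0"
      using add[OF V0_01] travel_limit_left[of V0] True V0_01 by simp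
    have "v_bar f (travel limit_slope V0 x) = x" if x: "x \<in> {0<..<1}" for x
    proof (cases "x \<le> v_plus f")
      case True
      thus ?thesis using add[OF x] t travel_limit_left[of x] x by (simp add: eq V_L_def V0_def)
    next
      case False
      have p: "travel (\<lambda>s. f s / cbar) (v_plus f) x > 0"
        using False x v_plus_01 by (intro inner.travel_pos) auto
      show ?thesis
        using add[OF x] t travel_limit_right[of "v_plus f" x] False p
          inner.flow_travel[OF v_plus_01(2) x, of "v_plus f - V0"] by (simp add: eq)
    qed
    thus ?thesis using v_bar_glue[OF eq L inner.flow_init[OF v_plus_01(2)]] by blast
  next
    case False
    hence lt: "v_plus f < V0" by simp
    note zp = z_plus[OF lt]
    have eq: "v_bar f = (\<lambda>z. if z \<le> z_plus f then V_L (z_plus f) (v_plus f) z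
        else inner.flow 0 V0 z)"
      using False unfolding v_bar_def[abs_def] V_I_eq[OF V0_01] by simp
    have L: "V_L (z_plus f) (v_plus f) (z_plus f) \<le> v_plus f" using v_plus_01 by (simp add: V_L_def)
    have zt: "z_plus f = travel (\<lambda>s. f s / cbar) V0 (v_plus f)"
      using zp(3) travel_limit_right[of V0 "v_plus f"] lt by simp
    have I: "inner.flow 0 V0 (z_plus f) = v_plus f"
      using inner.flow_travel[OF V0_01 v_plus_01(2), of 0] by (simp add: zt)
    have "v_bar f (travel limit_slope V0 x) = x" if x: "x \<in> {0<..<1}" for x
    proof (cases "x \<le> v_plus f")
      case True
      thus ?thesis using add[OF x] zp(3) travel_limit_left[of x] x by (simp add: eq V_L_def)
    next
      case False
      have "travel limit_slope (v_plus f) x > 0"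
        using False x v_plus_01 by (intro lim.travel_pos) auto
      hence "z_plus f < travel limit_slope V0 x" using add[OF x] zp(3) by simp
      moreover have "travel limit_slope V0 x = travel (\<lambda>s. f s / cbar) V0 x"
        using False lt by (intro travel_limit_right) auto
      ultimately show ?thesis using inner.flow_travel[OF V0_01 x, of 0] by (simp add: eq)
    qed
    thus ?thesis using v_bar_glue[OF eq L I] by blast
  qed
  thus "mono (v_bar f)" "range (v_bar f) \<subseteq> {0..1}"
    "\<And>x. x \<in> {0<..<1} \<Longrightarrow> v_bar f (travel limit_slope V0 x) = x" by auto
qed

lemma critical_profile_uniform_limit:
  "uniform_limit UNIV (critical_profile f V0) (v_bar f) (at_right 0)"
proof (rule uniform_limit_monotone[OF _ v_bar(1,2)])
  show "eventually (\<lambda>\<epsilon>. mono (critical_profile f V0 \<epsilon>) \<and> range (critical_profile f V0 \<epsilon>) \<subseteq> {0..1}) (at_right 0)"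
    using ev_pos
  proof eventually_elim
    case (elim \<epsilon>)
    interpret front_speed "speed_profile \<epsilon>" "cs \<epsilon> / \<epsilon> + sqrt (k / \<epsilon>)"
      by (rule front_speed_profile[OF elim])
    have "0 \<le> flow 0 V0 z" "flow 0 V0 z \<le> 1" for z using flow(1)[of 0 V0 z] by auto
    thus ?case by (auto simp: critical_profile_eq[OF elim V0_01] intro!: monoI flow_mono)
  qed
  show "\<exists>z. v_bar f z = x \<and> ((\<lambda>\<epsilon>. critical_profile f V0 \<epsilon> z) \<longlongrightarrow> x) (at_right 0)"
    if "x \<in> {0<..<1}" for x
    using v_bar(3)[OF that] critical_profile_at_limit_time[OF V0_01 that] by blast
qed

end

theorem theorem26:
  fixes f :: "real \<Rightarrow> real" and k :: real
  assumes "continuous_on {0..1} f"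
    and "f 0 = 0" and "f 1 = 0"
    and "k > 0"
    and "\<forall>s\<in>{0..1}. \<bar>f s\<bar> \<le> k * s \<and> \<bar>f s\<bar> \<le> k * (1 - s)"
    and "\<forall>s\<in>{0<..<1}. f s > 0"
    and "local_lipschitz (UNIV :: real set) {0<..<1} (\<lambda>_. f)"
    and "\<exists>!v_max. v_max \<in> {0<..<1} \<and> local_max_point_on {0..1} f v_max"
  shows "(critical_speed f \<longlongrightarrow> f (v_plus f)) (at_right 0)
    \<and> uniform_limit UNIV (critical_profile f V0) (v_bar f) (at_right 0)
    \<and> (v_plus f < V0 \<longrightarrow>
         (\<exists>!z. V_I f 0 V0 z = v_plus f) \<and> z_plus f < 0)"
proof -
  obtain m where m: "m \<in> {0<..<1}"
    and unique: "\<And>x. x \<in> {0<..<1} \<Longrightarrow> local_max_point_on {0..1} f x \<Longrightarrow> x = m"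
    using assms(8) by blast
  interpret unimodal_reaction f k m
  proof
    show "f s \<le> k * s" "f s \<le> k * (1 - s)" if "s \<in> {0..1}" for s
      using assms(5) that by fastforce+
    show pos: "f s > 0" if "s \<in> {0<..<1}" for s using assms(6) that by blast
    show "f a < f b" if "0 \<le> a" "a < b" "b \<le> m" for a b
      using unique_local_max_imp_unimodal(1)[OF assms(1-3) pos m unique] that by blast
    show "f b < f a" if "m \<le> a" "a < b" "b \<le> 1" for a b
      using unique_local_max_imp_unimodal(2)[OF assms(1-3) pos m unique] that by blast
  qed (use assms m in auto)
  show ?thesis
    using critical_speed_tendsto critical_profile_uniform_limit z_plus(1,2) by blast
qed

end
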